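(* Let the Smoothness, Hessian and Gradient Assumptions of the context hold for all $k\in\mathbb N$ for the iterates generated by the exact algorithm of the context. Set $\beta_k=\eta/\sqrt K$ (with $\eta>0$), $\alpha_k\in[\nu,\nu+\theta\beta_k]$ (with $\theta>0$), and $$\nu\in\Big(0,\min\Big\{\frac{\kappa_v\kappa_c^{-1}}{2\Gamma\omega^2},\,1-\theta\kappa_\beta\Big\}\Big].$$ Then for any $K\in\mathbb N$, $$\frac1K\sum_{k=0}^{K-1}\mathbb E\big[\|J_k^Tc_k\|^2\big]\le\frac{2\kappa_c(\|c_0\|+\eta^2\kappa_3)}{\nu\kappa_vK},$$ where $\kappa_3:=\Gamma\big(\theta^2\kappa_J^2\kappa_c^2\omega^2+\frac12(\zeta^{-1}\kappa_H\kappa_u^2+\zeta^{-2}M)\big)$.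
   Context: Problem: minimize $f(x)$ over $x\in\mathbb R^n$ subject to $c(x)=0$, with $f:\mathbb R^n\to\mathbb R$ (an expectation) and $c:\mathbb R^n\to\mathbb R^m$. $\|\cdot\|$ is the Euclidean norm (and induced matrix norm). $J(x)=\nabla c(x)^T\in\mathbb R^{m\times n}$, $c_k=c(x_k)$, $J_k=J(x_k)$. Smoothness Assumption: there is an open convex set $\mathcal X\subset\mathbb R^n$ containing all iterates $x_k$; on $\mathcal X$, $f$ is continuously differentiable and bounded, $\nabla f$ is bounded and Lipschitz with constant $L>0$, $c$ is continuously differentiable and bounded, $J$ is bounded and Lipschitz with constant $\Gamma>0$. Consequently there are constants $\kappa_g,\kappa_c,\kappa_J>0$ with $\|\nabla f(x_k)\|\le\kappa_g$, $\|c_k\|\le\kappa_c$, $\|J_k\|\le\kappa_J$ for all $k$; these are fixed. Hessian Assumption: for all $k$, $H_k$ is a symmetric $n\times n$ matrix chosen independently from $g_k$, $\|H_k\|\le\kappa_H$, and there is $\zeta>0$ with $u^TH_ku\ge\zeta\|u\|^2$ for all $u\in\mathrm{Null}(J_k)$. Gradient Assumption: for all $k$, the stochastic gradient estimate $g_k$ satisfies $\mathbb E_k[g_k]=\nabla f(x_k)$ and $\mathbb E_k[\|g_k-\nabla f(x_k)\|^2]\le M$ for some $M>0$, where $\mathbb E_k$ is the conditional expectation given the history up to $x_k$ (under which $x_k,v_k,H_k,\beta_k$ are treated as known). Exact algorithm: given $x_0$, at iteration $k$: (1) compute $v_k\in\mathrm{Range}(J_k^T)$, independently of $g_k$, as an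 approximate solution of $\min_v\frac12\|c_k+J_kv\|^2$ s.t. $\|v\|\le\omega\|J_k^Tc_k\|$ (with $\omega>0$ fixed) that is feasible and satisfies the Cauchy decrease condition $\|c_k\|-\|c_k+J_kv_k\|\ge\epsilon_v(\|c_k\|-\|c_k+\alpha_k^CJ_kv_k^C\|)$, where $\epsilon_v\in(0,1]$ is fixed, $v_k^C=-J_k^Tc_k$, and $\alpha_k^C$ minimizes $\frac12\|c_k+\alpha J_kv_k^C\|^2$ over $\alpha\le\omega$; (2) draw $g_k$ and let $u_k$ be the unique minimizer of $(g_k+H_kv_k)^Tu+\frac12u^TH_ku$ s.t. $J_ku=0$; (3) with a predefined $\beta_k>0$, $\beta_k\le\kappa_\beta$ for all $k$ ($\kappa_\beta>0$ a constant), set $d_k=\beta_ku_k+v_k$; (4) choose $\alpha_k>0$ and set $x_{k+1}=x_k+\alpha_kd_k$. The stepsize $\alpha_k$ may depend on $g_k$. Constants: $\kappa_v>0$ is a constant such that $\|c_k\|(\|c_k\|-\|c_k+J_kv_k\|)\ge\kappa_v\|J_k^Tc_k\|^2$ for all $k$ (such a constant exists under the Smoothness Assumption); $\kappa_u:=\zeta^{-1}(\kappa_g+\kappa_H\omega\kappa_J\kappa_c)$. *)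

theory Defs
  imports
    "HOL-Analysis.Analysis"
    "HOL-Probability.Probability"
    "HOL-Probability.Stopping_Time"
begin

text \<open>Induced (Euclidean) matrix norm. The type-class norm on \<^typ>\<open>real^'n^'m\<close> is the Frobenius norm,
  so it cannot be used here.\<close>

definition mnorm :: "real^'n^'m \<Rightarrow> real" where
  "mnorm A = onorm ((*v) A)"

definition gradient :: "(real^'n \<Rightarrow> real) \<Rightarrow> real^'n \<Rightarrow> real^'n" where
  "gradient f x = (THE D. GDERIV f x :> D)"

lemma gradient_works:
  fixes f :: "real^'n \<Rightarrow> real"
  assumes "f differentiable (at x)"
  shows "GDERIV f x :> gradient f x"
proof -
  obtain f' where f': "(f has_derivative f') (at x)"
    using assms by (auto simp: differentiable_def)
  then have lin: "linear f'"
    by (rule has_derivative_linear)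
  have "f' = (\<lambda>h. inner h (adjoint f' 1))"
    using adjoint_works[OF lin, of _ 1] by (auto simp: fun_eq_iff)
  with f' have D: "GDERIV f x :> adjoint f' 1"
    by (simp add: gderiv_def)
  moreover have "D = adjoint f' 1" if "GDERIV f x :> D" for D
  proof -
    have "(\<lambda>h. inner h D) = (\<lambda>h. inner h (adjoint f' 1))"
      using that D has_derivative_unique unfolding gderiv_def by blast
    then have "inner (D - adjoint f' 1) D = inner (D - adjoint f' 1) (adjoint f' 1)"
      by metis
    then have "inner (D - adjoint f' 1) (D - adjoint f' 1) = 0"
      by (simp add: inner_diff_right)
    then show ?thesis
      by simp
  qed
  ultimately show ?thesis
    unfolding gradient_def by (rule theI)
qed

text \<open>\<open>J x = \<nabla>c(x)\<^sup>T\<close>, an $m \times n$ matrix.\<close>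

definition J :: "(real^'n \<Rightarrow> real^'m) \<Rightarrow> real^'n \<Rightarrow> real^'n^'m" where
  "J c x = jacobian c (at x)"

text \<open>Throughout, the processes \<open>x, v, H, g, u, \<alpha>\<close> are indexed by the iteration and then by the sample
  point \<open>s\<close> of the probability space \<open>P\<close>; conditions on the iterates hold for every sample point.

  \<open>F k\<close> plays the role of the history up to \<open>x\<^sub>k\<close>, so \<open>\<bbbE>\<^sub>k\<close> is conditional expectation given \<open>F k\<close>.
  ``Chosen independently of \<open>g\<^sub>k\<close>'' for \<open>v\<^sub>k\<close> and \<open>H\<^sub>k\<close> means that they are known under \<open>\<bbbE>\<^sub>k\<close>, i.e.
  \<open>F k\<close>-measurable. The gradient estimate \<open>g\<^sub>k\<close> and the stepsize \<open>\<alpha>\<^sub>k\<close> are not known at time \<open>k\<close>.\<close>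

definition history ::
  "'s measure \<Rightarrow> (nat \<Rightarrow> 's measure) \<Rightarrow> (nat \<Rightarrow> 's \<Rightarrow> real^'n) \<Rightarrow> (nat \<Rightarrow> 's \<Rightarrow> real^'n)
    \<Rightarrow> (nat \<Rightarrow> 's \<Rightarrow> real^'n^'n) \<Rightarrow> (nat \<Rightarrow> 's \<Rightarrow> real^'n) \<Rightarrow> (nat \<Rightarrow> 's \<Rightarrow> real) \<Rightarrow> bool" where
  "history P F x v H g \<alpha> \<longleftrightarrow>
     prob_space P \<and> filtration (space P) F \<and>
     (\<forall>k. subalgebra P (F k) \<and>
        x k \<in> borel_measurable (F k) \<and> v k \<in> borel_measurable (F k) \<and>
        H k \<in> borel_measurable (F k) \<and>
        g k \<in> borel_measurable P \<and> \<alpha> k \<in> borel_measurable P)"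

definition smoothness_assumption ::
  "'s measure \<Rightarrow> (real^'n) set \<Rightarrow> (real^'n \<Rightarrow> real) \<Rightarrow> (real^'n \<Rightarrow> real^'m) \<Rightarrow> real \<Rightarrow> real
    \<Rightarrow> (nat \<Rightarrow> 's \<Rightarrow> real^'n) \<Rightarrow> bool" where
  "smoothness_assumption P X f c L \<Gamma> x \<longleftrightarrow>
     open X \<and> convex X \<and> (\<forall>k. \<forall>s\<in>space P. x k s \<in> X) \<and>
     L > 0 \<and> \<Gamma> > 0 \<and>
     (\<forall>y\<in>X. f differentiable (at y)) \<and> continuous_on X (gradient f) \<and> bounded (f ` X) \<and>
     bounded (gradient f ` X) \<and>
     (\<forall>y\<in>X. \<forall>z\<in>X. norm (gradient f y - gradient f z) \<le> L * norm (y - z)) \<and>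
     (\<forall>y\<in>X. c differentiable (at y)) \<and> continuous_on X (J c) \<and> bounded (c ` X) \<and>
     (\<exists>B. \<forall>y\<in>X. mnorm (J c y) \<le> B) \<and>
     (\<forall>y\<in>X. \<forall>z\<in>X. mnorm (J c y - J c z) \<le> \<Gamma> * norm (y - z))"

definition hessian_assumption ::
  "'s measure \<Rightarrow> (real^'n \<Rightarrow> real^'m) \<Rightarrow> real \<Rightarrow> real \<Rightarrow> (nat \<Rightarrow> 's \<Rightarrow> real^'n)
    \<Rightarrow> (nat \<Rightarrow> 's \<Rightarrow> real^'n^'n) \<Rightarrow> bool" where
  "hessian_assumption P c \<kappa>\<^sub>H \<zeta> x H \<longleftrightarrow>
     \<zeta> > 0 \<and>
     (\<forall>k. \<forall>s\<in>space P.
        transpose (H k s) = H k s \<and> mnorm (H k s) \<le> \<kappa>\<^sub>H \<and>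
        (\<forall>w. J c (x k s) *v w = 0 \<longrightarrow> inner w (H k s *v w) \<ge> \<zeta> * (norm w)\<^sup>2))"

text \<open>The second-moment bound uses the extended nonnegative conditional expectation, because
  \<^const>\<open>real_cond_exp\<close> takes junk values for non-integrable functions. Since \<open>\<nabla>f\<close> is bounded along the
  iterates, the bound makes \<open>g\<^sub>k\<close> integrable, so the componentwise conditional mean is well defined.\<close>

definition gradient_assumption ::
  "'s measure \<Rightarrow> (nat \<Rightarrow> 's measure) \<Rightarrow> (real^'n \<Rightarrow> real) \<Rightarrow> real \<Rightarrow> (nat \<Rightarrow> 's \<Rightarrow> real^'n)
    \<Rightarrow> (nat \<Rightarrow> 's \<Rightarrow> real^'n) \<Rightarrow> bool" where
  "gradient_assumption P F f M x g \<longleftrightarrow>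
     M > 0 \<and>
     (\<forall>k. AE s in P. \<forall>i. real_cond_exp P (F k) (\<lambda>s. g k s $ i) s = gradient f (x k s) $ i) \<and>
     (\<forall>k. AE s in P.
        nn_cond_exp P (F k) (\<lambda>s. ennreal ((norm (g k s - gradient f (x k s)))\<^sup>2)) s \<le> ennreal M)"

definition cauchy_step :: "(real^'n \<Rightarrow> real^'m) \<Rightarrow> real^'n \<Rightarrow> real^'n" where
  "cauchy_step c x = - (transpose (J c x) *v c x)"

text \<open>\<open>v\<close> is an admissible normal step at \<open>x\<close>, with \<open>a\<close> the stepsize along the Cauchy direction.\<close>

definition normal_step ::
  "(real^'n \<Rightarrow> real^'m) \<Rightarrow> real \<Rightarrow> real \<Rightarrow> real^'n \<Rightarrow> real \<Rightarrow> real^'n \<Rightarrow> bool" where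
  "normal_step c \<omega> \<epsilon>\<^sub>v x a v \<longleftrightarrow>
     v \<in> range (\<lambda>y. transpose (J c x) *v y) \<and>
     norm v \<le> \<omega> * norm (transpose (J c x) *v c x) \<and>
     is_arg_min (\<lambda>a. 1/2 * (norm (c x + a *\<^sub>R (J c x *v cauchy_step c x)))\<^sup>2) (\<lambda>a. a \<le> \<omega>) a \<and>
     norm (c x) - norm (c x + J c x *v v)
       \<ge> \<epsilon>\<^sub>v * (norm (c x) - norm (c x + a *\<^sub>R (J c x *v cauchy_step c x)))"

text \<open>\<open>u\<close> solves the tangential subproblem. The minimizer is automatically unique, by the curvature
  condition on the null space of the Jacobian in the Hessian assumption.\<close>

definition tangential_step ::
  "(real^'n \<Rightarrow> real^'m) \<Rightarrow> real^'n \<Rightarrow> real^'n^'n \<Rightarrow> real^'n \<Rightarrow> real^'n \<Rightarrow> real^'n \<Rightarrow> bool" where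
  "tangential_step c x H g v u \<longleftrightarrow>
     is_arg_min (\<lambda>w. inner (g + H *v v) w + 1/2 * inner w (H *v w)) (\<lambda>w. J c x *v w = 0) u"

definition exact_algorithm ::
  "'s measure \<Rightarrow> (real^'n \<Rightarrow> real^'m) \<Rightarrow> real \<Rightarrow> real \<Rightarrow> real \<Rightarrow> real^'n \<Rightarrow> (nat \<Rightarrow> real)
    \<Rightarrow> (nat \<Rightarrow> 's \<Rightarrow> real^'n) \<Rightarrow> (nat \<Rightarrow> 's \<Rightarrow> real) \<Rightarrow> (nat \<Rightarrow> 's \<Rightarrow> real^'n) \<Rightarrow> (nat \<Rightarrow> 's \<Rightarrow> real^'n^'n)
    \<Rightarrow> (nat \<Rightarrow> 's \<Rightarrow> real^'n) \<Rightarrow> (nat \<Rightarrow> 's \<Rightarrow> real^'n) \<Rightarrow> (nat \<Rightarrow> 's \<Rightarrow> real^'n) \<Rightarrow> (nat \<Rightarrow> 's \<Rightarrow> real)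
    \<Rightarrow> bool" where
  "exact_algorithm P c \<omega> \<epsilon>\<^sub>v \<kappa>\<^sub>\<beta> x\<^sub>0 \<beta> x \<alpha>C v H g u d \<alpha> \<longleftrightarrow>
     \<omega> > 0 \<and> \<epsilon>\<^sub>v \<in> {0<..1} \<and> \<kappa>\<^sub>\<beta> > 0 \<and>
     (\<forall>s\<in>space P. x 0 s = x\<^sub>0) \<and>
     (\<forall>k. 0 < \<beta> k \<and> \<beta> k \<le> \<kappa>\<^sub>\<beta>) \<and>
     (\<forall>k. \<forall>s\<in>space P.
        normal_step c \<omega> \<epsilon>\<^sub>v (x k s) (\<alpha>C k s) (v k s) \<and>
        tangential_step c (x k s) (H k s) (g k s) (v k s) (u k s) \<and>
        d k s = \<beta> k *\<^sub>R u k s + v k s \<and>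
        \<alpha> k s > 0 \<and>
        x (Suc k) s = x k s + \<alpha> k s *\<^sub>R d k s)"

end

theory Submission
  imports Defs
begin

text \<open>The merit function is \<open>norm c\<close>. Since \<open>J u = 0\<close> and \<open>u\<close> is orthogonal to \<open>v\<close>, the
  linearization error of \<open>c\<close> and \<open>\<alpha> \<le> 1\<close> show that a step decreases it by \<open>\<nu> \<kappa>\<^sub>v / (2 \<kappa>\<^sub>c)\<close> times
  the squared norm of \<open>J\<^sup>T c\<close>, up to an error of order \<open>\<beta>\<^sup>2 (1 + norm u ^ 2)\<close>; with
  \<open>\<beta>\<^sup>2 = \<eta>\<^sup>2 / K\<close> these errors sum to a constant.

  To bound the conditional second moment of \<open>u\<close>, compare it with the step \<open>u'\<close> obtained from the true
  gradient. The cross term of the square is linear in \<open>\<delta> = g - \<nabla>f\<close>: it equals \<open>- 2 w \<bullet> \<delta>\<close>, where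
  \<open>w\<close> solves the tangential problem with data \<open>- u'\<close>. As \<open>w\<close> is known under the conditional
  expectation, this term has mean zero. The measurability of \<open>u'\<close> and \<open>w\<close> is not immediate, because the
  rank of \<open>J\<close> may jump; they are obtained as pointwise limits of fixed-point iterations that are
  measurable in \<open>J\<close>, \<open>H\<close> and the data.\<close>

section \<open>Induced matrix norm, transposes and measurability\<close>

lemma norm_matrix_vector_le: "norm (A *v y) \<le> mnorm A * norm y"
  for A :: "real^'n^'m"
  unfolding mnorm_def by (rule onorm[OF matrix_vector_mul_bounded_linear])

lemma mnorm_nonneg: "0 \<le> mnorm A" for A :: "real^'n^'m"
  unfolding mnorm_def by (rule onorm_pos_le[OF matrix_vector_mul_bounded_linear])

lemma inner_transpose_left: "inner (transpose A *v y) z = inner y (A *v z)"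
  for A :: "real^'n^'m"
  by (simp add: dot_lmul_matrix)

text \<open>As a simplification rule it would turn \<open>transpose A *v y\<close> into
  \<open>y v* A\<close>, a form that the lemmas on transposes do not match.\<close>

declare transpose_matrix_vector [simp del]

lemma inner_matrix_symmetric:
  fixes H :: "real^'n^'n"
  assumes "transpose H = H"
  shows "inner (H *v y) z = inner y (H *v z)"
  using inner_transpose_left[of H y z] assms by simp

text \<open>The square of the left side is \<open>inner y (A *v (transpose A *v y))\<close>.
  Cauchy-Schwarz and the induced norm then leave one factor \<open>norm (transpose A *v y)\<close>
  to cancel.\<close>

lemma norm_transpose_vector_le: "norm (transpose A *v y) \<le> mnorm A * norm y"
  for A :: "real^'n^'m"
proof -
  have "(norm (transpose A *v y))\<^sup>2 = inner y (A *v (transpose A *v y))"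
    by (simp only: power2_norm_eq_inner inner_transpose_left)
  also have "\<dots> \<le> norm y * (mnorm A * norm (transpose A *v y))"
    by (rule order_trans[OF norm_cauchy_schwarz])
      (intro mult_left_mono norm_matrix_vector_le norm_ge_zero)
  finally show ?thesis
    by (cases "norm (transpose A *v y) = 0")
      (auto simp: power2_eq_square mult_ac mnorm_nonneg)
qed

lemma bounded_bilinear_matrix_vector_mult:
  "bounded_bilinear ((*v) :: real^'n^'m \<Rightarrow> real^'n \<Rightarrow> real^'m)"
  by (intro bilinear_conv_bounded_bilinear[THEN iffD1])
    (auto simp: bilinear_def linear_iff matrix_vector_right_distrib matrix_vector_mult_add_rdistrib
      matrix_vector_mult_scaleR scaleR_matrix_vector_assoc[symmetric])

lemma borel_measurable_matrix_vector_mult: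
  fixes A :: "'a \<Rightarrow> real^'n^'m"
  assumes "A \<in> borel_measurable N" "y \<in> borel_measurable N"
  shows "(\<lambda>s. A s *v y s) \<in> borel_measurable N"
  by (rule borel_measurable_continuous_Pair[OF assms], rule
      bounded_bilinear.continuous_on[OF bounded_bilinear_matrix_vector_mult])
    (rule continuous_intros)+

lemma borel_measurable_transpose:
  fixes A :: "'a \<Rightarrow> real^'n^'m"
  assumes "A \<in> borel_measurable N"
  shows "(\<lambda>s. transpose (A s)) \<in> borel_measurable N"
proof -
  have "linear (transpose :: real^'n^'m \<Rightarrow> real^'m^'n)"
    by (auto simp: linear_iff transpose_def vec_eq_iff)
  then have "continuous_on UNIV (transpose :: real^'n^'m \<Rightarrow> real^'m^'n)"
    using linear_continuous_on linear_conv_bounded_linear by blast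
  then show ?thesis
    by (rule borel_measurable_continuous_on[OF _ assms])
qed

text \<open>\<open>h\<close> may behave arbitrarily outside \<open>X\<close>, so \<open>y\<close> is
  read as a map into the restricted space.\<close>

lemma borel_measurable_continuous_on_open:
  fixes h :: "'b::topological_space \<Rightarrow> 'c::real_normed_vector"
  assumes "open X" "continuous_on X h" "y \<in> borel_measurable N" "\<And>s. s \<in> space N \<Longrightarrow> y s \<in> X"
  shows "(\<lambda>s. h (y s)) \<in> borel_measurable N"
  by (rule measurable_compose[where f=y and N="restrict_space borel X"])
    (use assms in \<open>auto intro!: borel_measurable_continuous_on_restrict measurable_restrict_space2\<close>)

section \<open>Linearization error of the constraints\<close>

lemma linearization_error:
  fixes c :: "real^'n \<Rightarrow> real^'m"
  assumes X: "convex X" "y \<in> X" "z \<in> X"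
    and diff: "\<And>w. w \<in> X \<Longrightarrow> c differentiable (at w)"
    and Lip: "\<And>a b. a \<in> X \<Longrightarrow> b \<in> X \<Longrightarrow> mnorm (J c a - J c b) \<le> \<Gamma> * norm (a - b)"
  shows "norm (c z - c y - J c y *v (z - y)) \<le> \<Gamma> / 2 * (norm (z - y))\<^sup>2"
proof -
  define h where "h = z - y"
  define e where "e = c z - c y - J c y *v h"
  \<comment> \<open>The error is tested against its own final value \<open>e\<close>, which reduces
    the vector estimate to monotonicity of a scalar function. \<open>\<phi>\<close> subtracts the
    linear model and the integral in \<open>t\<close> of the Lipschitz bound, so that
    \<open>\<phi> 1 \<le> \<phi> 0\<close> is the claim multiplied by \<open>norm e\<close>.\<close>
  define \<phi> where "\<phi> t = inner e (c (y + t *\<^sub>R h) - t *\<^sub>R (J c y *v h))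
    - \<Gamma> / 2 * norm e * (norm h)\<^sup>2 * t\<^sup>2" for t :: real
  have in_X: "y + t *\<^sub>R h \<in> X" if "0 \<le> t" "t \<le> 1" for t
    using convexD_alt[OF X that] by (simp add: h_def algebra_simps)
  have "\<phi> 1 \<le> \<phi> 0"
  proof (rule DERIV_nonpos_imp_nonincreasing[of 0 1 \<phi>])
    fix t :: real
    assume t: "0 \<le> t" "t \<le> 1"
    let ?D = "inner e ((J c (y + t *\<^sub>R h) - J c y) *v h) - \<Gamma> * norm e * (norm h)\<^sup>2 * t"
    have c': "(c has_derivative (\<lambda>k. J c (y + t *\<^sub>R h) *v k)) (at (y + t *\<^sub>R h))"
      using diff[OF in_X[OF t]] unfolding J_def jacobian_works .
    have "((\<lambda>t. c (y + t *\<^sub>R h)) has_derivative (\<lambda>r. J c (y + t *\<^sub>R h) *v (r *\<^sub>R h))) (at t)"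
      by (rule has_derivative_compose[where g=c and f="\<lambda>t. y + t *\<^sub>R h", OF _ c'])
        (auto intro!: derivative_eq_intros)
    then have "(\<phi> has_derivative (\<lambda>r. r * ?D)) (at t)"
      unfolding \<phi>_def
      by (auto intro!: derivative_eq_intros
          simp: algebra_simps inner_diff_right inner_add_right)
    then have "DERIV \<phi> t :> ?D"
      by (rule has_derivative_imp_has_field_derivative) simp
    moreover have "?D \<le> 0"
    proof -
      have "mnorm (J c (y + t *\<^sub>R h) - J c y) \<le> \<Gamma> * (t * norm h)"
        using Lip[OF in_X[OF t] X(2)] t by simp
      then have "norm ((J c (y + t *\<^sub>R h) - J c y) *v h) \<le> \<Gamma> * (t * norm h) * norm h"
        using norm_matrix_vector_le by (meson mult_right_mono norm_ge_zero order_trans)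
      then have "inner e ((J c (y + t *\<^sub>R h) - J c y) *v h) \<le> norm e * (\<Gamma> * (t * norm h) * norm h)"
        by (meson mult_left_mono norm_cauchy_schwarz norm_ge_zero order_trans)
      then show ?thesis
        by (simp add: power2_eq_square mult_ac)
    qed
    ultimately show "\<exists>D. DERIV \<phi> t :> D \<and> D \<le> 0"
      by blast
  qed simp
  then have "inner e e \<le> \<Gamma> / 2 * norm e * (norm h)\<^sup>2"
    by (simp add: \<phi>_def e_def h_def inner_diff_right algebra_simps)
  then have "norm e * norm e \<le> norm e * (\<Gamma> / 2 * (norm h)\<^sup>2)"
    by (simp add: power2_norm_eq_inner[symmetric] power2_eq_square mult_ac)
  \<comment> \<open>When \<open>norm e = 0\<close>, nothing can be cancelled and the right side has
    to be nonnegative; this follows from the Lipschitz bound at \<open>z\<close> and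
    \<open>y\<close>.\<close>
  moreover have "0 \<le> \<Gamma> * norm (z - y)"
    using Lip[OF X(3,2)] mnorm_nonneg order_trans by blast
  then have "0 \<le> \<Gamma> / 2 * (norm h)\<^sup>2"
    by (simp add: h_def power2_eq_square mult.assoc[symmetric])
  ultimately have "norm e \<le> \<Gamma> / 2 * (norm h)\<^sup>2"
    by (cases "norm e = 0") auto
  then show ?thesis
    by (simp add: e_def h_def)
qed

section \<open>First-order condition of the tangential subproblem\<close>

text \<open>First-order optimality with the multiplier eliminated by testing against the null space.
  The linear term \<open>b\<close> is left free because the problem is also solved for the true
  gradient, for the noise and for \<open>- u'\<close>.\<close>

definition stationary :: "real^'n^'m \<Rightarrow> real^'n^'n \<Rightarrow> real^'n \<Rightarrow> real^'n \<Rightarrow> bool" where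
  "stationary A H b u \<longleftrightarrow> A *v u = 0 \<and> (\<forall>z. A *v z = 0 \<longrightarrow> inner (b + H *v u) z = 0)"

text \<open>Moving from the minimizer by \<open>t *\<^sub>R z\<close> changes the objective by
  \<open>t * l + t\<^sup>2 * r\<close>, which is nonnegative for all \<open>t\<close> only if the
  slope \<open>l\<close> vanishes.\<close>

lemma tangential_step_stationary:
  assumes sym: "transpose H = H" and min: "tangential_step c x H g v u"
  shows "stationary (J c x) H (g + H *v v) u"
  unfolding stationary_def
proof (intro conjI allI impI)
  let ?A = "J c x" and ?b = "g + H *v v"
  let ?q = "\<lambda>w. inner ?b w + 1/2 * inner w (H *v w)"
  have u: "?A *v u = 0" and le: "?q u \<le> ?q w" if "?A *v w = 0" for w
    using min that by (auto simp: tangential_step_def is_arg_min_linorder)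
  show "?A *v u = 0"
    by (rule u[of 0]) simp
  fix z assume z: "?A *v z = 0"
  define l where "l = inner (?b + H *v u) z"
  define r where "r = 1/2 * inner z (H *v z)"
  have pos: "0 \<le> t * l + t\<^sup>2 * r" for t
  proof -
    have "?A *v (u + t *\<^sub>R z) = 0"
      using z \<open>?A *v u = 0\<close> by (simp add: algebra_simps)
    from le[OF this] have "0 \<le> t * inner ?b z + 1/2 * (t * inner u (H *v z) + t * inner z (H *v u))
        + t\<^sup>2 * r"
      by (simp add: r_def algebra_simps inner_add_left inner_add_right power2_eq_square)
    moreover have "inner u (H *v z) = inner (H *v u) z" "inner z (H *v u) = inner (H *v u) z"
      using inner_matrix_symmetric[OF sym] by (auto simp: inner_commute)
    ultimately show ?thesis
      by (simp add: l_def inner_add_left algebra_simps)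
  qed
  show "inner (?b + H *v u) z = 0"
  proof (rule ccontr)
    assume "inner (?b + H *v u) z \<noteq> 0"
    then have l: "l\<^sup>2 > 0" by (simp add: l_def)
    \<comment> \<open>As \<open>a\<close> exceeds \<open>\<bar>r\<bar>\<close>, the trial step
      \<open>- l / a\<close> is so short that the linear decrease dominates the quadratic term,
      whatever the sign of \<open>r\<close>.\<close>
    define a where "a = \<bar>r\<bar> + 1"
    have a: "a > 0" "r < a" by (auto simp: a_def)
    have "0 \<le> (- l / a) * l + (- l / a)\<^sup>2 * r"
      by (rule pos)
    then have "0 \<le> (r - a) * l\<^sup>2"
      using a by (simp add: power2_eq_square field_simps)
    with l a show False
      by (simp add: zero_le_mult_iff)
  qed
qed

section \<open>Measurable solutions as limits of fixed-point iterations\<close>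

text \<open>Contraction toward the single point \<open>p\<close>, on a set preserved by
  \<open>T\<close>, suffices; this covers both the descent to the null-space projection and the
  projected gradient iteration.\<close>

lemma contraction_iterates_tendsto:
  fixes T :: "'a::real_normed_vector \<Rightarrow> 'a"
  assumes q: "0 \<le> q" "q < 1" and "w \<in> S"
    and S: "\<And>w. w \<in> S \<Longrightarrow> T w \<in> S"
    and contr: "\<And>w. w \<in> S \<Longrightarrow> norm (T w - p) \<le> q * norm (w - p)"
  shows "(\<lambda>n. (T ^^ n) w) \<longlonglongrightarrow> p"
proof -
  have in_S: "(T ^^ n) w \<in> S" for n
    by (induction n) (simp_all add: \<open>w \<in> S\<close> S)
  have "norm ((T ^^ n) w - p) \<le> q ^ n * norm (w - p)" for n
  proof (induction n)
    case (Suc n)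
    have "norm ((T ^^ Suc n) w - p) \<le> q * norm ((T ^^ n) w - p)"
      using contr[OF in_S] by simp
    also have "\<dots> \<le> q * (q ^ n * norm (w - p))"
      by (intro mult_left_mono Suc.IH q)
    finally show ?case
      by (simp add: mult.assoc)
  qed simp
  moreover have "(\<lambda>n. q ^ n * norm (w - p)) \<longlonglongrightarrow> 0"
    using LIMSEQ_power_zero[of q] q by (intro tendsto_mult_left_zero) auto
  ultimately have "(\<lambda>n. (T ^^ n) w - p) \<longlonglongrightarrow> 0"
    by (rule Lim_null_comparison[OF always_eventually, OF allI])
  then show ?thesis
    by (rule LIM_zero_cancel)
qed

text \<open>\<open>null_proj A\<close> is the orthogonal projection onto the null space of \<open>A\<close>: stationarity with
  \<open>H = mat 1\<close> and \<open>b = - y\<close> says that \<open>p - y\<close> is orthogonal to the null space.\<close>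

definition null_proj :: "real^'n^'m \<Rightarrow> real^'n \<Rightarrow> real^'n" where
  "null_proj A y = (SOME p. stationary A (mat 1) (- y) p)"

lemma subspace_null: "subspace {z. A *v z = 0}" for A :: "real^'n^'m"
  by (auto simp: subspace_def algebra_simps)

lemma null_proj:
  fixes A :: "real^'n^'m"
  shows null_proj_null: "A *v null_proj A y = 0"
    and inner_null_proj: "A *v z = 0 \<Longrightarrow> inner (null_proj A y) z = inner y z"
proof -
  obtain p r where "p \<in> span {z. A *v z = 0}"
    and "\<And>w. w \<in> span {z. A *v z = 0} \<Longrightarrow> orthogonal r w" and "y = p + r"
    using orthogonal_subspace_decomp_exists[of "{z. A *v z = 0}" y] by metis
  then have "stationary A (mat 1) (- y) p"
    by (auto simp: stationary_def orthogonal_def span_eq_iff[THEN iffD2, OF subspace_null])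
  then have "stationary A (mat 1) (- y) (null_proj A y)"
    unfolding null_proj_def by (rule someI)
  then show "A *v null_proj A y = 0"
    and "A *v z = 0 \<Longrightarrow> inner (null_proj A y) z = inner y z"
    by (auto simp: stationary_def inner_diff_left)
qed

text \<open>Gradient descent on \<open>norm (A w) ^ 2 / 2\<close> from \<open>y\<close> leaves the null-space component unchanged and
  contracts the orthogonal one. The step size depends only on a bound of \<open>A\<close>.\<close>

lemma null_proj_iteration:
  fixes A :: "real^'n^'m"
  assumes A: "mnorm A \<le> \<kappa>" and \<kappa>: "\<kappa> > 0"
  shows "(\<lambda>n. ((\<lambda>w. w - (1 / \<kappa>\<^sup>2) *\<^sub>R (transpose A *v (A *v w))) ^^ n) y) \<longlonglongrightarrow> null_proj A y"
proof -
  \<comment> \<open>The orthogonal complement of the null space. \<open>A\<close> is injective on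
    it, hence bounded below by some \<open>\<sigma>\<close>; this constant depends on
    \<open>A\<close> but affects only the rate, never the iteration itself.\<close>
  define N where "N = {r. \<forall>z. A *v z = 0 \<longrightarrow> inner r z = 0}"
  have "subspace N"
    by (auto simp: N_def subspace_def inner_add_left)
  have "\<forall>r\<in>N. A *v r = 0 \<longrightarrow> r = 0"
    unfolding N_def using inner_eq_zero_iff by blast
  with \<open>subspace N\<close> obtain \<sigma> where \<sigma>: "\<sigma> > 0" "\<And>r. r \<in> N \<Longrightarrow> \<sigma> * norm r \<le> norm (A *v r)"
    using injective_imp_isometric[OF closed_subspace, of N "(*v) A"] matrix_vector_mul_bounded_linear
    by blast
  define p where "p = null_proj A y"
  \<comment> \<open>The square of \<open>q\<close> is the contraction factor of the squared norm.
    The \<open>max\<close> guards the case \<open>N = {0}\<close>, where \<open>\<sigma>\<close> may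
    be arbitrarily large.\<close>
  define q where "q = sqrt (max 0 (1 - 1 / \<kappa>\<^sup>2 * \<sigma>\<^sup>2))"
  show ?thesis
    unfolding p_def[symmetric]
  proof (rule contraction_iterates_tendsto)
    show "0 \<le> q" "q < 1"
      using \<sigma> \<kappa> by (auto simp: q_def max_def)
    show "y \<in> {w. w - p \<in> N}"
      by (simp add: N_def p_def inner_diff_left inner_null_proj)
    fix w assume "w \<in> {w. w - p \<in> N}"
    define r where "r = w - p"
    define a where "a = transpose A *v (A *v r)"
    have r: "r \<in> N"
      using \<open>w \<in> _\<close> by (simp add: r_def)
    have step: "w - (1 / \<kappa>\<^sup>2) *\<^sub>R (transpose A *v (A *v w)) - p = r - (1 / \<kappa>\<^sup>2) *\<^sub>R a"
      by (simp add: r_def a_def algebra_simps null_proj_null p_def)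
    have "a \<in> N"
      by (simp add: N_def a_def inner_transpose_left)
    then show "w - (1 / \<kappa>\<^sup>2) *\<^sub>R (transpose A *v (A *v w)) \<in> {w. w - p \<in> N}"
      using r \<open>subspace N\<close> by (simp add: step subspace_diff subspace_scale)
    have "norm a \<le> \<kappa> * norm (A *v r)"
      unfolding a_def by (meson norm_transpose_vector_le A mult_right_mono norm_ge_zero order_trans)
    then have a: "(norm a)\<^sup>2 \<le> \<kappa>\<^sup>2 * (norm (A *v r))\<^sup>2"
      by (metis norm_ge_zero power_mono power_mult_distrib)
    have ra: "inner r a = (norm (A *v r))\<^sup>2"
      by (metis a_def inner_commute inner_transpose_left power2_norm_eq_inner)
    \<comment> \<open>With step \<open>1 / \<kappa>\<^sup>2\<close>, the quadratic term consumes at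
      most half of the linear decrease.\<close>
    have "(norm (r - (1 / \<kappa>\<^sup>2) *\<^sub>R a))\<^sup>2
        = (norm r)\<^sup>2 - 2 / \<kappa>\<^sup>2 * inner r a + (1 / \<kappa>\<^sup>2)\<^sup>2 * (norm a)\<^sup>2"
      unfolding power2_norm_eq_inner
      by (simp add: inner_diff_left inner_diff_right inner_commute power2_eq_square)
    also have "\<dots> \<le> (norm r)\<^sup>2 - 2 / \<kappa>\<^sup>2 * inner r a + (1 / \<kappa>\<^sup>2)\<^sup>2 * (\<kappa>\<^sup>2 * (norm (A *v r))\<^sup>2)"
      by (intro add_left_mono mult_left_mono a) simp
    also have "\<dots> = (norm r)\<^sup>2 - 1 / \<kappa>\<^sup>2 * (norm (A *v r))\<^sup>2"
      using \<kappa> by (simp add: ra power2_eq_square field_simps)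
    also have "\<dots> \<le> (norm r)\<^sup>2 - 1 / \<kappa>\<^sup>2 * (\<sigma> * norm r)\<^sup>2"
      using \<sigma> r by (intro diff_left_mono mult_left_mono power_mono) auto
    also have "\<dots> = (1 - 1 / \<kappa>\<^sup>2 * \<sigma>\<^sup>2) * (norm r)\<^sup>2"
      by (simp add: power_mult_distrib algebra_simps)
    also have "\<dots> \<le> q\<^sup>2 * (norm r)\<^sup>2"
      by (intro mult_right_mono) (auto simp: q_def)
    finally have "(norm (r - (1 / \<kappa>\<^sup>2) *\<^sub>R a))\<^sup>2 \<le> (q * norm r)\<^sup>2"
      by (simp add: power_mult_distrib)
    then have "norm (r - (1 / \<kappa>\<^sup>2) *\<^sub>R a) \<le> q * norm r"
      by (rule power2_le_imp_le) (simp add: q_def)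
    then show "norm (w - (1 / \<kappa>\<^sup>2) *\<^sub>R (transpose A *v (A *v w)) - p) \<le> q * norm (w - p)"
      unfolding step r_def .
  qed
qed

text \<open>One \<open>\<kappa>\<close> for all sample points gives a common step size, so every
  iterate arises from \<open>A\<close> and \<open>y\<close> by measurable operations.\<close>

lemma borel_measurable_null_proj:
  fixes A :: "'a \<Rightarrow> real^'n^'m"
  assumes A [measurable]: "A \<in> borel_measurable N" and y [measurable]: "y \<in> borel_measurable N"
    and bound: "\<And>s. s \<in> space N \<Longrightarrow> mnorm (A s) \<le> \<kappa>" and \<kappa>: "\<kappa> > 0"
  shows "(\<lambda>s. null_proj (A s) (y s)) \<in> borel_measurable N"
proof (rule borel_measurable_LIMSEQ_metric)
  show "(\<lambda>s. ((\<lambda>w. w - (1 / \<kappa>\<^sup>2) *\<^sub>R (transpose (A s) *v (A s *v w))) ^^ n) (y s))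
      \<in> borel_measurable N" for n
  proof (induction n)
    case (Suc n)
    then show ?case
      by (auto intro!: borel_measurable_diff borel_measurable_scaleR borel_measurable_transpose
          borel_measurable_matrix_vector_mult A)
  qed simp
qed (rule null_proj_iteration[OF bound \<kappa>])

text \<open>A projected gradient step of length \<open>\<tau>\<close> for the quadratic of the
  tangential subproblem.\<close>

definition tangential_iteration ::
  "real^'n^'m \<Rightarrow> real^'n^'n \<Rightarrow> real^'n \<Rightarrow> real \<Rightarrow> real^'n \<Rightarrow> real^'n" where
  "tangential_iteration A H b \<tau> w = w - \<tau> *\<^sub>R null_proj A (b + H *v w)"

lemma tangential_iteration_null:
  "A *v w = 0 \<Longrightarrow> A *v tangential_iteration A H b \<tau> w = 0"
  by (simp add: tangential_iteration_def null_proj_null algebra_simps)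

text \<open>On the null space the projected \<open>H\<close> is strongly monotone with constant
  \<open>\<zeta>\<close> and Lipschitz with constant \<open>\<kappa>\<close>. The squared factor is
  thus at most \<open>1 - 2 * \<tau> * \<zeta> + \<tau>\<^sup>2 * \<kappa>\<^sup>2\<close>, and
  \<open>\<tau> = \<zeta> / \<kappa>\<^sup>2\<close> minimizes this.\<close>

lemma tangential_iteration_contraction:
  assumes H: "mnorm H \<le> \<kappa>" and \<zeta>: "0 < \<zeta>"
    and curv: "\<And>w. A *v w = 0 \<Longrightarrow> inner w (H *v w) \<ge> \<zeta> * (norm w)\<^sup>2"
    and \<kappa>: "\<zeta> \<le> \<kappa>" and null: "A *v w = 0" "A *v w' = 0"
  shows "norm (tangential_iteration A H b (\<zeta> / \<kappa>\<^sup>2) w - tangential_iteration A H b (\<zeta> / \<kappa>\<^sup>2) w')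
    \<le> sqrt (1 - \<zeta>\<^sup>2 / \<kappa>\<^sup>2) * norm (w - w')"
proof -
  define e where "e = w - w'"
  define D where "D = null_proj A (b + H *v w) - null_proj A (b + H *v w')"
  define \<tau> where "\<tau> = \<zeta> / \<kappa>\<^sup>2"
  have "\<kappa> > 0" using \<zeta> \<kappa> by simp
  have e: "A *v e = 0" and "A *v D = 0"
    using null by (auto simp: e_def D_def null_proj_null algebra_simps)
  have D: "inner D z = inner (H *v e) z" if "A *v z = 0" for z
    using that by (simp add: D_def e_def inner_diff_left inner_add_left inner_null_proj algebra_simps)
  \<comment> \<open>\<open>D\<close> is the projection of \<open>H *v e\<close>; testing it with
    itself shows that projecting does not increase the norm.\<close>
  have "norm D * norm D = inner (H *v e) D"
    using D[OF \<open>A *v D = 0\<close>] by (simp add: power2_norm_eq_inner[symmetric] power2_eq_square)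
  also have "\<dots> \<le> norm (H *v e) * norm D"
    by (rule norm_cauchy_schwarz)
  finally have "norm D \<le> norm (H *v e)"
    by (cases "norm D = 0") auto
  also have "\<dots> \<le> \<kappa> * norm e"
    by (meson H mult_right_mono norm_ge_zero norm_matrix_vector_le order_trans)
  finally have "(norm D)\<^sup>2 \<le> \<kappa>\<^sup>2 * (norm e)\<^sup>2"
    by (metis norm_ge_zero power_mono power_mult_distrib)
  moreover have "\<zeta> * (norm e)\<^sup>2 \<le> inner D e"
    using curv[OF e] D[OF e] by (simp add: inner_commute)
  moreover have "0 \<le> \<tau>" using \<zeta> by (simp add: \<tau>_def)
  moreover have "(norm (e - \<tau> *\<^sub>R D))\<^sup>2 = (norm e)\<^sup>2 - 2 * \<tau> * inner D e + \<tau>\<^sup>2 * (norm D)\<^sup>2"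
    unfolding power2_norm_eq_inner
    by (simp add: inner_diff_left inner_diff_right inner_commute power2_eq_square)
  ultimately have "(norm (e - \<tau> *\<^sub>R D))\<^sup>2
      \<le> (norm e)\<^sup>2 - 2 * \<tau> * (\<zeta> * (norm e)\<^sup>2) + \<tau>\<^sup>2 * (\<kappa>\<^sup>2 * (norm e)\<^sup>2)"
    by (smt (verit) mult_left_mono zero_le_power2)
  also have "\<dots> = (1 - \<zeta>\<^sup>2 / \<kappa>\<^sup>2) * (norm e)\<^sup>2"
    using \<open>\<kappa> > 0\<close> by (simp add: \<tau>_def power2_eq_square field_simps)
  finally have "norm (e - \<tau> *\<^sub>R D) \<le> sqrt ((1 - \<zeta>\<^sup>2 / \<kappa>\<^sup>2) * (norm e)\<^sup>2)"
    by (rule real_le_rsqrt)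
  moreover have "tangential_iteration A H b \<tau> w - tangential_iteration A H b \<tau> w' = e - \<tau> *\<^sub>R D"
    by (simp add: tangential_iteration_def e_def D_def algebra_simps)
  ultimately show ?thesis
    by (simp add: \<tau>_def e_def real_sqrt_mult)
qed

text \<open>The null space is complete, so Banach's theorem yields a fixed point. Since the step
  length is positive, the projected gradient vanishes there, which is stationarity. The iterates
  from 0 are recorded for the sake of measurability.\<close>

lemma stationary_tangential_limit:
  assumes H: "mnorm H \<le> \<kappa>" and \<zeta>: "0 < \<zeta>"
    and curv: "\<And>w. A *v w = 0 \<Longrightarrow> inner w (H *v w) \<ge> \<zeta> * (norm w)\<^sup>2"
    and \<kappa>: "\<zeta> \<le> \<kappa>"
  obtains u where "stationary A H b u"
    "(\<lambda>n. (tangential_iteration A H b (\<zeta> / \<kappa>\<^sup>2) ^^ n) 0) \<longlonglongrightarrow> u"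
proof -
  define q where "q = sqrt (1 - \<zeta>\<^sup>2 / \<kappa>\<^sup>2)"
  define T where "T = tangential_iteration A H b (\<zeta> / \<kappa>\<^sup>2)"
  have "\<zeta>\<^sup>2 \<le> \<kappa>\<^sup>2"
    using \<zeta> \<kappa> by (simp add: power_mono)
  then have q: "0 \<le> q" "q < 1"
    using \<zeta> \<kappa> by (auto simp: q_def)
  have contr: "norm (T w - T w') \<le> q * norm (w - w')" if "A *v w = 0" "A *v w' = 0" for w w'
    unfolding T_def q_def by (rule tangential_iteration_contraction[OF H \<zeta> curv \<kappa> that])
  have null: "A *v T w = 0" if "A *v w = 0" for w
    unfolding T_def by (rule tangential_iteration_null[OF that])
  have "\<exists>!u\<in>{w. A *v w = 0}. T u = u"
  proof (rule Banach_fix[OF complete_subspace[OF subspace_null]])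
    have "0 \<in> {w. A *v w = 0}" by simp
    then show "{w. A *v w = 0} \<noteq> {}" by blast
  qed (use q contr null in \<open>auto simp: dist_norm\<close>)
  then obtain u where u: "A *v u = 0" "T u = u" by auto
  have "null_proj A (b + H *v u) = 0"
    using u(2) \<zeta> \<kappa> by (auto simp: T_def tangential_iteration_def)
  then have "stationary A H b u"
    unfolding stationary_def using u(1) inner_null_proj by (metis inner_zero_left)
  moreover have "(\<lambda>n. (T ^^ n) 0) \<longlonglongrightarrow> u"
    by (rule contraction_iterates_tendsto[OF q, where S="{w. A *v w = 0}"])
      (use contr[OF _ u(1)] u null in auto)
  ultimately show thesis
    by (intro that) (simp_all add: T_def)
qed

lemma measurable_stationary:
  fixes A :: "'a \<Rightarrow> real^'n^'m"
  assumes A: "A \<in> borel_measurable N" and H: "H \<in> borel_measurable N"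
    and b: "b \<in> borel_measurable N"
    and \<kappa>\<^sub>A: "\<kappa>\<^sub>A > 0" "\<And>s. s \<in> space N \<Longrightarrow> mnorm (A s) \<le> \<kappa>\<^sub>A"
    and \<kappa>\<^sub>H: "\<And>s. s \<in> space N \<Longrightarrow> mnorm (H s) \<le> \<kappa>\<^sub>H"
    and \<zeta>: "0 < \<zeta>"
    and curv: "\<And>s w. s \<in> space N \<Longrightarrow> A s *v w = 0 \<Longrightarrow> inner w (H s *v w) \<ge> \<zeta> * (norm w)\<^sup>2"
  shows "\<exists>u\<in>borel_measurable N. \<forall>s\<in>space N. stationary (A s) (H s) (b s) (u s)"
proof -
  \<comment> \<open>The contraction requires \<open>\<zeta> \<le> \<kappa>\<close>, which
    \<open>\<kappa>\<^sub>H\<close> alone may violate when the null spaces are trivial.\<close>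
  define \<kappa> where "\<kappa> = max \<zeta> \<kappa>\<^sub>H"
  define T where "T s = tangential_iteration (A s) (H s) (b s) (\<zeta> / \<kappa>\<^sup>2)" for s
  have "\<exists>u. stationary (A s) (H s) (b s) u \<and> (\<lambda>n. (T s ^^ n) 0) \<longlonglongrightarrow> u"
    if s: "s \<in> space N" for s
  proof -
    have "mnorm (H s) \<le> \<kappa>" "\<zeta> \<le> \<kappa>"
      using \<kappa>\<^sub>H[OF s] by (auto simp: \<kappa>_def)
    then show ?thesis
      using stationary_tangential_limit[OF _ \<zeta> curv[OF s]] unfolding T_def by blast
  qed
  then obtain u where u: "\<And>s. s \<in> space N \<Longrightarrow> stationary (A s) (H s) (b s) (u s)"
    and lim: "\<And>s. s \<in> space N \<Longrightarrow> (\<lambda>n. (T s ^^ n) 0) \<longlonglongrightarrow> u s"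
    by metis
  have "(\<lambda>s. (T s ^^ n) 0) \<in> borel_measurable N" for n
  proof (induction n)
    case (Suc n)
    then show ?case
      by (auto simp: T_def tangential_iteration_def intro!: borel_measurable_diff
          borel_measurable_scaleR borel_measurable_null_proj[OF A _ \<kappa>\<^sub>A(2,1)] borel_measurable_add b
          borel_measurable_matrix_vector_mult H)
  qed simp
  then have "u \<in> borel_measurable N"
    by (rule borel_measurable_LIMSEQ_metric[OF _ lim])
  then show ?thesis
    using u by blast
qed

section \<open>Size of the tangential step\<close>

text \<open>Stationarity is tested with \<open>u\<close> itself, so that curvature gives
  \<open>\<zeta> * (norm u)\<^sup>2 \<le> - inner b u\<close>.\<close>

lemma stationary_norm_le:
  assumes u: "stationary A H b u" and \<zeta>: "0 < \<zeta>"
    and curv: "\<And>w. A *v w = 0 \<Longrightarrow> inner w (H *v w) \<ge> \<zeta> * (norm w)\<^sup>2"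
  shows "norm u \<le> inverse \<zeta> * norm b"
proof -
  have "A *v u = 0" "inner (b + H *v u) u = 0"
    using u by (auto simp: stationary_def)
  then have "\<zeta> * (norm u)\<^sup>2 \<le> - inner b u"
    using curv[of u] by (simp add: inner_add_left inner_commute[of u])
  also have "\<dots> \<le> norm b * norm u"
    using norm_cauchy_schwarz[of "- b" u] by simp
  finally have "(\<zeta> * norm u) * norm u \<le> norm b * norm u"
    by (simp add: power2_eq_square)
  then have "\<zeta> * norm u \<le> norm b"
    by (cases "norm u = 0") auto
  then show ?thesis
    using \<zeta> by (simp add: field_simps)
qed

text \<open>By linearity \<open>u - u'\<close> solves the problem with data \<open>\<delta>\<close>
  alone, so its size is controlled by the noise; \<open>w\<close> turns the remaining cross term
  into one linear in \<open>\<delta>\<close>.\<close>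

lemma stationary_perturbation:
  assumes u: "stationary A H (b + \<delta>) u" and u': "stationary A H b u'"
    and w: "stationary A H (- u') w"
    and sym: "transpose H = H" and H: "mnorm H \<le> \<kappa>\<^sub>H" and \<zeta>: "0 < \<zeta>"
    and curv: "\<And>w. A *v w = 0 \<Longrightarrow> inner w (H *v w) \<ge> \<zeta> * (norm w)\<^sup>2"
  shows "(norm u)\<^sup>2 \<le> inverse \<zeta> * \<kappa>\<^sub>H * (inverse \<zeta> * norm b)\<^sup>2
    - 2 * inner w \<delta> + (inverse \<zeta>)\<^sup>2 * (norm \<delta>)\<^sup>2"
proof -
  define e where "e = u - u'"
  have null: "A *v e = 0" "A *v u' = 0" "A *v w = 0"
    using u u' w by (auto simp: stationary_def e_def algebra_simps)
  have e: "stationary A H \<delta> e"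
    unfolding stationary_def
  proof (intro conjI allI impI null)
    fix z assume "A *v z = 0"
    then have "inner (b + \<delta> + H *v u) z = 0" "inner (b + H *v u') z = 0"
      using u u' by (auto simp: stationary_def)
    then show "inner (\<delta> + H *v e) z = 0"
      by (simp add: e_def inner_add_left inner_diff_left matrix_vector_mult_diff_distrib)
  qed
  \<comment> \<open>The conditions on \<open>w\<close> and \<open>e\<close> are tested against each
    other; symmetry of \<open>H\<close> equates their left sides.\<close>
  have "inner (H *v w) e = inner u' e"
    using w null(1) by (auto simp: stationary_def inner_diff_left)
  moreover have "inner (H *v e) w = - inner \<delta> w"
    using e null(3) by (auto simp: stationary_def inner_add_left)
  moreover have "inner (H *v w) e = inner (H *v e) w"
    using inner_matrix_symmetric[OF sym] by (simp add: inner_commute)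
  ultimately have cross: "inner u' e = - inner w \<delta>"
    by (simp add: inner_commute)
  have "(norm e)\<^sup>2 \<le> (inverse \<zeta> * norm \<delta>)\<^sup>2"
    by (intro power_mono stationary_norm_le[OF e \<zeta> curv]) auto
  \<comment> \<open>The factor \<open>inverse \<zeta> * \<kappa>\<^sub>H\<close> is at least 1
    unless \<open>u'\<close> is zero; inserting it gives the form that enters
    \<open>\<kappa>\<^sub>3\<close>.\<close>
  moreover have "(norm u')\<^sup>2 \<le> inverse \<zeta> * \<kappa>\<^sub>H * (inverse \<zeta> * norm b)\<^sup>2"
  proof -
    have "inner u' (H *v u') \<le> norm u' * norm (H *v u')"
      by (rule norm_cauchy_schwarz)
    also have "\<dots> \<le> norm u' * (\<kappa>\<^sub>H * norm u')"
      by (meson H mult_left_mono mult_right_mono norm_ge_zero norm_matrix_vector_le order_trans)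
    finally have "\<zeta> * (norm u')\<^sup>2 \<le> \<kappa>\<^sub>H * (norm u')\<^sup>2"
      using curv[OF null(2)] by (simp add: power2_eq_square mult_ac)
    then have "(norm u')\<^sup>2 \<le> inverse \<zeta> * \<kappa>\<^sub>H * (norm u')\<^sup>2"
      using \<zeta> by (simp add: field_simps)
    also have "\<dots> \<le> inverse \<zeta> * \<kappa>\<^sub>H * (inverse \<zeta> * norm b)\<^sup>2"
      using \<zeta> H mnorm_nonneg[of H]
      by (intro mult_left_mono power_mono stationary_norm_le[OF u' \<zeta> curv]) auto
    finally show ?thesis .
  qed
  moreover have "(norm u)\<^sup>2 = (norm u')\<^sup>2 + 2 * inner u' e + (norm e)\<^sup>2"
    unfolding power2_norm_eq_inner
    by (simp add: e_def inner_diff_left inner_diff_right inner_commute)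
  ultimately show ?thesis
    by (simp add: cross power_mult_distrib)
qed

section \<open>Decrease of the constraint norm in one step\<close>

lemma constraint_decrease:
  fixes c :: "real^'n \<Rightarrow> real^'m"
  assumes X: "convex X" "y \<in> X" "y + \<alpha> *\<^sub>R (\<beta> *\<^sub>R u + v) \<in> X"
    and diff: "\<And>w. w \<in> X \<Longrightarrow> c differentiable (at w)"
    and \<Gamma>: "0 < \<Gamma>"
      "\<And>a b. a \<in> X \<Longrightarrow> b \<in> X \<Longrightarrow> mnorm (J c a - J c b) \<le> \<Gamma> * norm (a - b)"
    and \<kappa>\<^sub>c: "0 < \<kappa>\<^sub>c" "norm (c y) \<le> \<kappa>\<^sub>c" and \<kappa>\<^sub>J: "mnorm (J c y) \<le> \<kappa>\<^sub>J"
    and u: "J c y *v u = 0"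
    and v: "v \<in> range (\<lambda>z. transpose (J c y) *v z)"
      "norm v \<le> \<omega> * norm (transpose (J c y) *v c y)"
    and \<kappa>\<^sub>v: "0 < \<kappa>\<^sub>v" "\<kappa>\<^sub>v * (norm (transpose (J c y) *v c y))\<^sup>2
      \<le> norm (c y) * (norm (c y) - norm (c y + J c y *v v))"
    and \<omega>: "0 < \<omega>"
    and \<nu>: "0 < \<nu>" "\<nu> \<le> \<kappa>\<^sub>v * inverse \<kappa>\<^sub>c / (2 * \<Gamma> * \<omega>\<^sup>2)"
    and \<alpha>: "\<nu> \<le> \<alpha>" "\<alpha> \<le> \<nu> + \<theta> * \<beta>" "\<alpha> \<le> 1"
  shows "\<nu> * \<kappa>\<^sub>v / (2 * \<kappa>\<^sub>c) * (norm (transpose (J c y) *v c y))\<^sup>2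
    \<le> norm (c y) - norm (c (y + \<alpha> *\<^sub>R (\<beta> *\<^sub>R u + v)))
      + \<Gamma> * \<beta>\<^sup>2 * (\<theta>\<^sup>2 * \<kappa>\<^sub>J\<^sup>2 * \<kappa>\<^sub>c\<^sup>2 * \<omega>\<^sup>2 + 1/2 * (norm u)\<^sup>2)"
proof -
  define d where "d = \<beta> *\<^sub>R u + v"
  define h where "h = norm (transpose (J c y) *v c y)"
  define \<Delta> where "\<Delta> = norm (c y) - norm (c y + J c y *v v)"
  \<comment> \<open>The guaranteed linearized decrease is \<open>2 * S\<close>: one \<open>S\<close>
    absorbs the \<open>\<nu>\<^sup>2\<close> part of the normal-step error, the other is the claim.
    \<open>W\<close> bounds the normal-step error of order \<open>\<beta>\<^sup>2\<close>.\<close>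
  define S where "S = \<nu> * \<kappa>\<^sub>v / (2 * \<kappa>\<^sub>c) * h\<^sup>2"
  define W where "W = \<Gamma> * \<beta>\<^sup>2 * (\<theta>\<^sup>2 * \<kappa>\<^sub>J\<^sup>2 * \<kappa>\<^sub>c\<^sup>2 * \<omega>\<^sup>2)"
  have h: "0 \<le> h" "h \<le> \<kappa>\<^sub>J * \<kappa>\<^sub>c"
    unfolding h_def using \<kappa>\<^sub>J \<kappa>\<^sub>c
    by (auto intro!: order_trans[OF norm_transpose_vector_le] mult_mono
        order_trans[OF mnorm_nonneg \<kappa>\<^sub>J])
  \<comment> \<open>At \<open>c y = 0\<close> the inequality for \<open>\<kappa>\<^sub>v\<close>
    does not determine the sign of \<open>\<Delta>\<close>, but the length bound forces
    \<open>v = 0\<close>.\<close>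
  have "0 \<le> \<Delta>"
  proof (cases "c y = 0")
    case True
    then show ?thesis using v(2) by (simp add: \<Delta>_def)
  next
    case False
    have "0 \<le> norm (c y) * \<Delta>"
      using \<kappa>\<^sub>v by (auto simp: \<Delta>_def intro: order_trans[rotated])
    with False show ?thesis by (simp add: zero_le_mult_iff)
  qed
  then have "norm (c y) * \<Delta> \<le> \<kappa>\<^sub>c * \<Delta>"
    by (intro mult_right_mono \<kappa>\<^sub>c)
  with \<kappa>\<^sub>v(2) have "\<kappa>\<^sub>v * h\<^sup>2 \<le> \<kappa>\<^sub>c * \<Delta>"
    by (simp add: h_def \<Delta>_def)
  then have "\<kappa>\<^sub>v / \<kappa>\<^sub>c * h\<^sup>2 \<le> \<Delta>"
    using \<kappa>\<^sub>c by (simp add: field_simps)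
  then have "\<nu> * (\<kappa>\<^sub>v / \<kappa>\<^sub>c * h\<^sup>2) \<le> \<alpha> * \<Delta>"
    using \<nu> \<alpha> \<kappa>\<^sub>v(1) \<kappa>\<^sub>c(1) by (intro mult_mono) auto
  then have decrease: "\<nu> * \<kappa>\<^sub>v / \<kappa>\<^sub>c * h\<^sup>2 \<le> \<alpha> * \<Delta>"
    by (simp add: mult.assoc)
  have Jd: "J c y *v d = J c y *v v"
    by (simp add: d_def u matrix_vector_right_distrib matrix_vector_mult_scaleR)
  \<comment> \<open>For \<open>\<alpha> \<le> 1\<close> the linear model is a convex combination of
    \<open>c y\<close> and its value at the full normal step.\<close>
  have "norm (c y + \<alpha> *\<^sub>R (J c y *v v))
      = norm ((1 - \<alpha>) *\<^sub>R c y + \<alpha> *\<^sub>R (c y + J c y *v v))"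
    by (simp add: algebra_simps)
  also have "\<dots> \<le> (1 - \<alpha>) * norm (c y) + \<alpha> * norm (c y + J c y *v v)"
    by (rule order_trans[OF norm_triangle_ineq]) (use \<alpha> \<nu> in simp)
  also have "\<dots> = norm (c y) - \<alpha> * \<Delta>"
    by (simp add: \<Delta>_def algebra_simps)
  finally have lin: "norm (c y + \<alpha> *\<^sub>R (J c y *v v)) \<le> norm (c y) - \<alpha> * \<Delta>" .
  have "norm (c (y + \<alpha> *\<^sub>R d) - c y - \<alpha> *\<^sub>R (J c y *v v)) \<le> \<Gamma> / 2 * (norm (\<alpha> *\<^sub>R d))\<^sup>2"
    using linearization_error[OF X(1,2) _ diff \<Gamma>(2), of "y + \<alpha> *\<^sub>R d"] X(3)
    by (simp add: Jd d_def[symmetric] matrix_vector_mult_scaleR)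
  moreover have "norm (c (y + \<alpha> *\<^sub>R d)) \<le> norm (c y + \<alpha> *\<^sub>R (J c y *v v))
      + norm (c (y + \<alpha> *\<^sub>R d) - c y - \<alpha> *\<^sub>R (J c y *v v))"
    by (metis add_diff_cancel_left' diff_diff_eq norm_triangle_sub)
  moreover have "(norm (\<alpha> *\<^sub>R d))\<^sup>2 = \<alpha>\<^sup>2 * \<beta>\<^sup>2 * (norm u)\<^sup>2 + \<alpha>\<^sup>2 * (norm v)\<^sup>2"
  proof -
    obtain z where "v = transpose (J c y) *v z"
      using v(1) by auto
    then have "inner v u = 0"
      using u by (simp add: inner_transpose_left)
    then have "(norm d)\<^sup>2 = \<beta>\<^sup>2 * (norm u)\<^sup>2 + (norm v)\<^sup>2"
      unfolding power2_norm_eq_inner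
      by (simp add: d_def inner_add_left inner_add_right inner_commute power2_eq_square)
    then show ?thesis
      by (simp add: power_mult_distrib algebra_simps)
  qed
  ultimately have upper: "norm (c (y + \<alpha> *\<^sub>R d)) \<le> norm (c y) - \<alpha> * \<Delta>
      + \<Gamma> / 2 * (\<alpha>\<^sup>2 * \<beta>\<^sup>2 * (norm u)\<^sup>2) + \<Gamma> / 2 * (\<alpha>\<^sup>2 * (norm v)\<^sup>2)"
    using lin by (simp add: algebra_simps)
  have "\<alpha>\<^sup>2 \<le> 1"
    using \<alpha> \<nu> by (simp add: power_le_one)
  then have tangential: "\<Gamma> / 2 * (\<alpha>\<^sup>2 * \<beta>\<^sup>2 * (norm u)\<^sup>2) \<le> \<Gamma> / 2 * (\<beta>\<^sup>2 * (norm u)\<^sup>2)"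
    using \<Gamma>(1) mult_right_mono[of "\<alpha>\<^sup>2" 1 "\<beta>\<^sup>2 * (norm u)\<^sup>2"] by (simp add: mult.assoc)
  \<comment> \<open>The split separates the \<open>\<nu>\<^sup>2\<close> part, to be absorbed by
    \<open>S\<close>, from the \<open>\<beta>\<^sup>2\<close> part, which goes into
    \<open>W\<close>.\<close>
  have "\<alpha>\<^sup>2 \<le> (\<nu> + \<theta> * \<beta>)\<^sup>2"
    using \<alpha> \<nu> by (intro power_mono) auto
  also have "\<dots> \<le> 2 * \<nu>\<^sup>2 + 2 * \<theta>\<^sup>2 * \<beta>\<^sup>2"
    using sum_squares_bound[of \<nu> "\<theta> * \<beta>"] by (simp add: power2_sum power_mult_distrib algebra_simps)
  finally have \<alpha>2: "\<alpha>\<^sup>2 \<le> 2 * \<nu>\<^sup>2 + 2 * \<theta>\<^sup>2 * \<beta>\<^sup>2" .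
  have "(norm v)\<^sup>2 \<le> \<omega>\<^sup>2 * h\<^sup>2"
    using power_mono[OF v(2), of 2] by (simp add: h_def power_mult_distrib)
  then have "\<alpha>\<^sup>2 * (norm v)\<^sup>2 \<le> (2 * \<nu>\<^sup>2 + 2 * \<theta>\<^sup>2 * \<beta>\<^sup>2) * (\<omega>\<^sup>2 * h\<^sup>2)"
    using \<alpha>2 by (intro mult_mono) auto
  then have "\<Gamma> / 2 * (\<alpha>\<^sup>2 * (norm v)\<^sup>2) \<le> \<Gamma> / 2 * ((2 * \<nu>\<^sup>2 + 2 * \<theta>\<^sup>2 * \<beta>\<^sup>2) * (\<omega>\<^sup>2 * h\<^sup>2))"
    using \<Gamma>(1) by (intro mult_left_mono) auto
  also have "\<dots> = \<nu> * (\<nu> * (\<Gamma> * \<omega>\<^sup>2)) * h\<^sup>2 + \<Gamma> * \<beta>\<^sup>2 * (\<theta>\<^sup>2 * h\<^sup>2 * \<omega>\<^sup>2)"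
    by (simp add: power2_eq_square field_simps)
  also have "\<dots> \<le> \<nu> * (\<kappa>\<^sub>v / (2 * \<kappa>\<^sub>c)) * h\<^sup>2 + \<Gamma> * \<beta>\<^sup>2 * (\<theta>\<^sup>2 * (\<kappa>\<^sub>J * \<kappa>\<^sub>c)\<^sup>2 * \<omega>\<^sup>2)"
  proof (intro add_mono mult_right_mono mult_left_mono power_mono h)
    \<comment> \<open>The first upper bound on \<open>\<nu>\<close> is exactly what makes the
      \<open>\<nu>\<^sup>2\<close> part fit into \<open>S\<close>.\<close>
    have "0 < 2 * \<Gamma> * \<omega>\<^sup>2"
      using \<Gamma> \<omega> by simp
    then have "\<nu> * (2 * \<Gamma> * \<omega>\<^sup>2) \<le> \<kappa>\<^sub>v * inverse \<kappa>\<^sub>c"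
      using \<nu>(2) by (simp add: pos_le_divide_eq)
    then show "\<nu> * (\<Gamma> * \<omega>\<^sup>2) \<le> \<kappa>\<^sub>v / (2 * \<kappa>\<^sub>c)"
      by (simp add: field_simps)
  qed (use \<nu> \<Gamma> in auto)
  finally have "\<Gamma> / 2 * (\<alpha>\<^sup>2 * (norm v)\<^sup>2)
      \<le> \<nu> * \<kappa>\<^sub>v / (2 * \<kappa>\<^sub>c) * h\<^sup>2 + \<Gamma> * \<beta>\<^sup>2 * (\<theta>\<^sup>2 * \<kappa>\<^sub>J\<^sup>2 * \<kappa>\<^sub>c\<^sup>2 * \<omega>\<^sup>2)"
    by (simp add: power_mult_distrib mult.assoc)
  then have normal: "\<Gamma> / 2 * (\<alpha>\<^sup>2 * (norm v)\<^sup>2) \<le> S + W"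
    by (simp add: S_def W_def)
  have "2 * S \<le> \<alpha> * \<Delta>"
    using decrease by (simp add: S_def)
  then have "S \<le> norm (c y) - norm (c (y + \<alpha> *\<^sub>R d)) + (W + \<Gamma> / 2 * (\<beta>\<^sup>2 * (norm u)\<^sup>2))"
    using upper tangential normal by linarith
  also have "W + \<Gamma> / 2 * (\<beta>\<^sup>2 * (norm u)\<^sup>2)
      = \<Gamma> * \<beta>\<^sup>2 * (\<theta>\<^sup>2 * \<kappa>\<^sub>J\<^sup>2 * \<kappa>\<^sub>c\<^sup>2 * \<omega>\<^sup>2 + 1/2 * (norm u)\<^sup>2)"
    by (simp add: W_def algebra_simps)
  finally show ?thesis
    by (simp add: S_def h_def d_def)
qed

section \<open>Moments of the gradient noise\<close>

text \<open>The nonnegative conditional expectation preserves integrals before finiteness is known,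
  so the conditional bound itself delivers integrability.\<close>

lemma (in finite_measure_subalgebra) square_integrable_cond_bound:
  fixes g m :: "'a \<Rightarrow> real^'n"
  assumes g: "g \<in> borel_measurable M" and m: "m \<in> borel_measurable F"
    and V: "0 \<le> V" "AE s in M. nn_cond_exp M F (\<lambda>s. ennreal ((norm (g s - m s))\<^sup>2)) s \<le> ennreal V"
  shows "integrable M (\<lambda>s. (norm (g s - m s))\<^sup>2)"
    and "(\<integral>s. (norm (g s - m s))\<^sup>2 \<partial>M) \<le> V * measure M (space M)"
proof -
  have [measurable]: "g \<in> borel_measurable M" "m \<in> borel_measurable M"
    using g measurable_from_subalg[OF subalg m] by auto
  have "(\<integral>\<^sup>+s. ennreal ((norm (g s - m s))\<^sup>2) \<partial>M)
      = (\<integral>\<^sup>+s. nn_cond_exp M F (\<lambda>s. ennreal ((norm (g s - m s))\<^sup>2)) s \<partial>M)"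
    using nn_cond_exp_intg[of "\<lambda>_. 1" "\<lambda>s. ennreal ((norm (g s - m s))\<^sup>2)"] by simp
  also have "\<dots> \<le> (\<integral>\<^sup>+s. ennreal V \<partial>M)"
    by (rule nn_integral_mono_AE[OF V(2)])
  also have "\<dots> = ennreal (V * measure M (space M))"
    using V(1) by (simp add: emeasure_eq_measure ennreal_mult)
  finally have le: "(\<integral>\<^sup>+s. ennreal ((norm (g s - m s))\<^sup>2) \<partial>M) \<le> ennreal (V * measure M (space M))" .
  then show "integrable M (\<lambda>s. (norm (g s - m s))\<^sup>2)"
    by (intro integrableI_bounded) (auto simp: le_less_trans[OF le ennreal_less_top])
  show "(\<integral>s. (norm (g s - m s))\<^sup>2 \<partial>M) \<le> V * measure M (space M)"
    using V(1) by (intro integral_real_bounded[OF _ le]) auto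
qed

text \<open>In each component the bounded \<open>F\<close>-measurable factor \<open>w s $ i\<close>
  can be kept while \<open>g\<close> is replaced by its conditional mean \<open>m\<close>.\<close>

lemma (in finite_measure_subalgebra) inner_centered_integral_zero:
  fixes g m w :: "'a \<Rightarrow> real^'n"
  assumes g: "g \<in> borel_measurable M" and m: "m \<in> borel_measurable F"
    and w: "w \<in> borel_measurable F"
    and m_bound: "\<And>s. s \<in> space M \<Longrightarrow> norm (m s) \<le> B"
    and w_bound: "\<And>s. s \<in> space M \<Longrightarrow> norm (w s) \<le> B'"
    and int: "integrable M (\<lambda>s. (norm (g s - m s))\<^sup>2)"
    and mean: "AE s in M. \<forall>i. real_cond_exp M F (\<lambda>s. g s $ i) s = m s $ i"
  shows "integrable M (\<lambda>s. inner (w s) (g s - m s))"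
    and "(\<integral>s. inner (w s) (g s - m s) \<partial>M) = 0"
proof -
  have [measurable]: "g \<in> borel_measurable M" "m \<in> borel_measurable M" "w \<in> borel_measurable M"
    using g measurable_from_subalg[OF subalg m] measurable_from_subalg[OF subalg w] by auto
  have [measurable]: "(\<lambda>s. m s $ i) \<in> borel_measurable M" "(\<lambda>s. g s $ i) \<in> borel_measurable M"
    "(\<lambda>s. w s $ i) \<in> borel_measurable M" "(\<lambda>s. (g s - m s) $ i) \<in> borel_measurable M" for i
    by (rule measurable_compose[OF _ borel_measurable_nth]; measurable)+
  have wF: "(\<lambda>s. w s $ i) \<in> borel_measurable F" for i
    using w by (rule measurable_compose) simp
  have int_m: "integrable M (\<lambda>s. m s $ i)" for i
    by (rule integrable_const_bound[where B=B])
      (auto intro!: AE_I2 order_trans[OF component_le_norm_cart] m_bound)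
  \<comment> \<open>A finite second moment dominates the first, because
    \<open>\<bar>t\<bar> \<le> 1 + t\<^sup>2\<close>.\<close>
  have int_gm: "integrable M (\<lambda>s. (g s - m s) $ i)" for i
  proof (rule Bochner_Integration.integrable_bound)
    show "integrable M (\<lambda>s. 1 + (norm (g s - m s))\<^sup>2)"
      using int by simp
    have "norm ((g s - m s) $ i) \<le> norm (1 + (norm (g s - m s))\<^sup>2)" for s
    proof -
      have "2 * norm (g s - m s) \<le> 1 + (norm (g s - m s))\<^sup>2"
        using sum_squares_bound[of 1 "norm (g s - m s)"] by simp
      then show ?thesis
        using component_le_norm_cart[of "g s - m s" i] norm_ge_zero[of "g s - m s"]
        by simp
    qed
    then show "AE s in M. norm ((g s - m s) $ i) \<le> norm (1 + (norm (g s - m s))\<^sup>2)"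
      by simp
  qed measurable
  have int_g: "integrable M (\<lambda>s. g s $ i)" for i
    using Bochner_Integration.integrable_add[OF int_gm[of i] int_m[of i]] by simp
  have mult_w: "integrable M (\<lambda>s. w s $ i * y s)" if "integrable M y" for i and y :: "'a \<Rightarrow> real"
  proof (rule Bochner_Integration.integrable_bound)
    show "integrable M (\<lambda>s. B' * y s)"
      using that by simp
    have [measurable]: "y \<in> borel_measurable M" using that by auto
    show "(\<lambda>s. w s $ i * y s) \<in> borel_measurable M" by measurable
    show "AE s in M. norm (w s $ i * y s) \<le> norm (B' * y s)"
    proof (rule AE_I2)
      fix s assume "s \<in> space M"
      then have "\<bar>w s $ i\<bar> \<le> \<bar>B'\<bar>"
        using component_le_norm_cart[of "w s" i] w_bound by fastforce
      then show "norm (w s $ i * y s) \<le> norm (B' * y s)"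
        by (simp add: abs_mult mult_right_mono)
    qed
  qed
  have eq: "inner (w s) (g s - m s) = (\<Sum>i\<in>UNIV. w s $ i * g s $ i - w s $ i * m s $ i)" for s
    by (simp add: inner_vec_def right_diff_distrib)
  show "integrable M (\<lambda>s. inner (w s) (g s - m s))"
    unfolding eq by (intro Bochner_Integration.integrable_sum Bochner_Integration.integrable_diff
        mult_w int_g int_m)
  have "(\<integral>s. w s $ i * g s $ i \<partial>M) = (\<integral>s. w s $ i * m s $ i \<partial>M)" for i
  proof -
    have "(\<integral>s. w s $ i * g s $ i \<partial>M)
        = (\<integral>s. w s $ i * real_cond_exp M F (\<lambda>s. g s $ i) s \<partial>M)"
      by (rule real_cond_exp_intg(2)[symmetric, OF mult_w[OF int_g] wF]) simp
    also have "\<dots> = (\<integral>s. w s $ i * m s $ i \<partial>M)"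
      by (rule integral_cong_AE) (use mean in auto)
    finally show ?thesis .
  qed
  then show "(\<integral>s. inner (w s) (g s - m s) \<partial>M) = 0"
    unfolding eq
    by (subst Bochner_Integration.integral_sum)
      (auto intro!: Bochner_Integration.integrable_diff mult_w int_g int_m sum.neutral
        simp: Bochner_Integration.integral_diff mult_w int_g int_m)
qed

section \<open>Expected decrease and summation over the iterations\<close>

theorem theorem3p19:
  fixes P :: "'s measure" and F :: "nat \<Rightarrow> 's measure"
    and f :: "real^'n \<Rightarrow> real" and c :: "real^'n \<Rightarrow> real^'m"
    and X :: "(real^'n) set" and x\<^sub>0 :: "real^'n"
    and x v g u d :: "nat \<Rightarrow> 's \<Rightarrow> real^'n" and H :: "nat \<Rightarrow> 's \<Rightarrow> real^'n^'n"
    and \<alpha> \<alpha>C :: "nat \<Rightarrow> 's \<Rightarrow> real" and \<beta> :: "nat \<Rightarrow> real"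
    and L \<Gamma> \<kappa>\<^sub>g \<kappa>\<^sub>c \<kappa>\<^sub>J \<kappa>\<^sub>H \<zeta> M \<omega> \<epsilon>\<^sub>v \<kappa>\<^sub>\<beta> \<kappa>\<^sub>v \<kappa>\<^sub>u \<kappa>\<^sub>3 \<eta> \<theta> \<nu> :: real and K :: nat
  assumes history: "history P F x v H g \<alpha>"
    and smoothness: "smoothness_assumption P X f c L \<Gamma> x"
    and hessian: "hessian_assumption P c \<kappa>\<^sub>H \<zeta> x H"
    and grad: "gradient_assumption P F f M x g"
    and algorithm: "exact_algorithm P c \<omega> \<epsilon>\<^sub>v \<kappa>\<^sub>\<beta> x\<^sub>0 \<beta> x \<alpha>C v H g u d \<alpha>"
    and \<kappa>\<^sub>g: "\<kappa>\<^sub>g > 0" "\<forall>k. \<forall>s\<in>space P. norm (gradient f (x k s)) \<le> \<kappa>\<^sub>g"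
    and \<kappa>\<^sub>c: "\<kappa>\<^sub>c > 0" "\<forall>k. \<forall>s\<in>space P. norm (c (x k s)) \<le> \<kappa>\<^sub>c"
    and \<kappa>\<^sub>J: "\<kappa>\<^sub>J > 0" "\<forall>k. \<forall>s\<in>space P. mnorm (J c (x k s)) \<le> \<kappa>\<^sub>J"
    and \<kappa>\<^sub>v: "\<kappa>\<^sub>v > 0"
      "\<forall>k. \<forall>s\<in>space P.
         norm (c (x k s)) * (norm (c (x k s)) - norm (c (x k s) + J c (x k s) *v v k s))
           \<ge> \<kappa>\<^sub>v * (norm (transpose (J c (x k s)) *v c (x k s)))\<^sup>2"
    and \<kappa>\<^sub>u: "\<kappa>\<^sub>u = inverse \<zeta> * (\<kappa>\<^sub>g + \<kappa>\<^sub>H * \<omega> * \<kappa>\<^sub>J * \<kappa>\<^sub>c)"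
    and \<kappa>\<^sub>3: "\<kappa>\<^sub>3 = \<Gamma> * (\<theta>\<^sup>2 * \<kappa>\<^sub>J\<^sup>2 * \<kappa>\<^sub>c\<^sup>2 * \<omega>\<^sup>2
                   + 1/2 * (inverse \<zeta> * \<kappa>\<^sub>H * \<kappa>\<^sub>u\<^sup>2 + (inverse \<zeta>)\<^sup>2 * M))"
    and K: "K \<ge> 1"
    and \<beta>: "\<eta> > 0" "\<forall>k. \<beta> k = \<eta> / sqrt (real K)"
    and \<alpha>: "\<theta> > 0" "\<forall>k. \<forall>s\<in>space P. \<alpha> k s \<in> {\<nu>..\<nu> + \<theta> * \<beta> k}"
    and \<nu>: "\<nu> \<in> {0<..min (\<kappa>\<^sub>v * inverse \<kappa>\<^sub>c / (2 * \<Gamma> * \<omega>\<^sup>2)) (1 - \<theta> * \<kappa>\<^sub>\<beta>)}"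
  shows "1 / real K *
           (\<Sum>k<K. \<integral>s. (norm (transpose (J c (x k s)) *v c (x k s)))\<^sup>2 \<partial>P)
         \<le> 2 * \<kappa>\<^sub>c * (norm (c x\<^sub>0) + \<eta>\<^sup>2 * \<kappa>\<^sub>3) / (\<nu> * \<kappa>\<^sub>v * real K)"
proof -
  interpret P: prob_space P
    using history by (simp add: history_def)
  have F: "subalgebra P (F k)" and xF: "x k \<in> borel_measurable (F k)"
    and vF: "v k \<in> borel_measurable (F k)" and HF: "H k \<in> borel_measurable (F k)"
    and gP: "g k \<in> borel_measurable P" for k
    using history by (auto simp: history_def)
  have space_F: "space (F k) = space P" for k
    using F by (simp add: subalgebra_def)
  have X: "open X" "convex X" and xX: "\<And>k s. s \<in> space P \<Longrightarrow> x k s \<in> X"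
    and \<Gamma>: "0 < \<Gamma>"
    and grad_cont: "continuous_on X (gradient f)" and J_cont: "continuous_on X (J c)"
    and c_diff: "\<And>y. y \<in> X \<Longrightarrow> c differentiable (at y)"
    and J_Lip: "\<And>y z. y \<in> X \<Longrightarrow> z \<in> X \<Longrightarrow> mnorm (J c y - J c z) \<le> \<Gamma> * norm (y - z)"
    using smoothness by (auto simp: smoothness_assumption_def)
  have c_cont: "continuous_on X c"
    using c_diff by (intro continuous_at_imp_continuous_on) (auto intro: differentiable_imp_continuous_within)
  have \<zeta>: "0 < \<zeta>" and H_sym: "\<And>k s. s \<in> space P \<Longrightarrow> transpose (H k s) = H k s"
    and H_bound: "\<And>k s. s \<in> space P \<Longrightarrow> mnorm (H k s) \<le> \<kappa>\<^sub>H"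
    and curv: "\<And>k s w. s \<in> space P \<Longrightarrow> J c (x k s) *v w = 0
      \<Longrightarrow> inner w (H k s *v w) \<ge> \<zeta> * (norm w)\<^sup>2"
    using hessian by (auto simp: hessian_assumption_def)
  have M: "0 < M"
    and mean: "\<And>k. AE s in P. \<forall>i. real_cond_exp P (F k) (\<lambda>s. g k s $ i) s = gradient f (x k s) $ i"
    and var: "\<And>k. AE s in P.
      nn_cond_exp P (F k) (\<lambda>s. ennreal ((norm (g k s - gradient f (x k s)))\<^sup>2)) s \<le> ennreal M"
    using grad by (auto simp: gradient_assumption_def)
  have \<omega>: "0 < \<omega>" and x0: "\<And>s. s \<in> space P \<Longrightarrow> x 0 s = x\<^sub>0"
    and \<beta>_bounds: "\<And>k. 0 < \<beta> k" "\<And>k. \<beta> k \<le> \<kappa>\<^sub>\<beta>"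
    and v_step: "\<And>k s. s \<in> space P \<Longrightarrow> normal_step c \<omega> \<epsilon>\<^sub>v (x k s) (\<alpha>C k s) (v k s)"
    and u_step: "\<And>k s. s \<in> space P \<Longrightarrow> tangential_step c (x k s) (H k s) (g k s) (v k s) (u k s)"
    and x_step: "\<And>k s. s \<in> space P \<Longrightarrow> x (Suc k) s = x k s + \<alpha> k s *\<^sub>R (\<beta> k *\<^sub>R u k s + v k s)"
    using algorithm by (auto simp: exact_algorithm_def)
  have \<kappa>\<^sub>c': "norm (c (x k s)) \<le> \<kappa>\<^sub>c" and \<kappa>\<^sub>J': "mnorm (J c (x k s)) \<le> \<kappa>\<^sub>J"
    and \<kappa>\<^sub>g': "norm (gradient f (x k s)) \<le> \<kappa>\<^sub>g" if "s \<in> space P" for k s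
    using that \<kappa>\<^sub>c(2) \<kappa>\<^sub>J(2) \<kappa>\<^sub>g(2) by auto
  \<comment> \<open>Measurability in \<open>F k\<close>, and not only in \<open>P\<close>, is what
    later lets \<open>w\<close> count as known under the conditional expectation.\<close>
  have JF: "(\<lambda>s. J c (x k s)) \<in> borel_measurable (F k)"
    and cF: "(\<lambda>s. c (x k s)) \<in> borel_measurable (F k)"
    and gradF: "(\<lambda>s. gradient f (x k s)) \<in> borel_measurable (F k)" for k
    using borel_measurable_continuous_on_open[OF X(1) _ xF] xX J_cont c_cont grad_cont
    by (auto simp: space_F)
  define h where "h k s = norm (transpose (J c (x k s)) *v c (x k s))" for k s
  have h_bound: "h k s \<le> \<kappa>\<^sub>J * \<kappa>\<^sub>c" if "s \<in> space P" for k s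
    unfolding h_def using \<kappa>\<^sub>J'[OF that] \<kappa>\<^sub>c'[OF that] \<kappa>\<^sub>J(1)
    by (intro order_trans[OF norm_transpose_vector_le] mult_mono) auto
  have int_c: "integrable P (\<lambda>s. norm (c (x k s)))" for k
    using measurable_from_subalg[OF F cF]
    by (intro P.integrable_const_bound[where B=\<kappa>\<^sub>c]) (auto simp: \<kappa>\<^sub>c')
  have int_h: "integrable P (\<lambda>s. (h k s)\<^sup>2)" for k
  proof (rule P.integrable_const_bound)
    have "(\<lambda>s. transpose (J c (x k s)) *v c (x k s)) \<in> borel_measurable (F k)"
      by (intro borel_measurable_matrix_vector_mult borel_measurable_transpose JF cF)
    from measurable_from_subalg[OF F this] show "(\<lambda>s. (h k s)\<^sup>2) \<in> borel_measurable P"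
      unfolding h_def by measurable
    show "AE s in P. norm ((h k s)\<^sup>2) \<le> (\<kappa>\<^sub>J * \<kappa>\<^sub>c)\<^sup>2"
      using h_bound by (intro AE_I2) (auto simp: h_def intro!: power_mono)
  qed
  define a where "a = \<nu> * \<kappa>\<^sub>v / (2 * \<kappa>\<^sub>c)"
  define C where "C k = (\<integral>s. norm (c (x k s)) \<partial>P)" for k
  have decrease: "a * (\<integral>s. (h k s)\<^sup>2 \<partial>P) \<le> C k - C (Suc k) + (\<beta> k)\<^sup>2 * \<kappa>\<^sub>3" for k
  proof -
    interpret Fk: finite_measure_subalgebra P "F k"
      by unfold_locales (rule F)
    define m where "m s = gradient f (x k s)" for s
    define b where "b s = m s + H k s *v v k s" for s
    have mF: "m \<in> borel_measurable (F k)"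
      using gradF by (simp add: m_def[abs_def])
    have bF: "b \<in> borel_measurable (F k)"
      unfolding b_def[abs_def] by (intro borel_measurable_add borel_measurable_matrix_vector_mult mF HF vF)
    have b_bound: "inverse \<zeta> * norm (b s) \<le> \<kappa>\<^sub>u" if s: "s \<in> space P" for s
    proof -
      have "norm (v k s) \<le> \<omega> * (\<kappa>\<^sub>J * \<kappa>\<^sub>c)"
        using v_step[OF s, of k] h_bound[OF s, of k] \<omega>
        by (auto simp: normal_step_def h_def intro: order_trans mult_left_mono)
      then have "norm (H k s *v v k s) \<le> \<kappa>\<^sub>H * (\<omega> * (\<kappa>\<^sub>J * \<kappa>\<^sub>c))"
        using H_bound[OF s, of k] mnorm_nonneg[of "H k s"]
        by (intro order_trans[OF norm_matrix_vector_le] mult_mono) auto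
      then have "norm (b s) \<le> \<kappa>\<^sub>g + \<kappa>\<^sub>H * (\<omega> * (\<kappa>\<^sub>J * \<kappa>\<^sub>c))"
        unfolding b_def m_def using \<kappa>\<^sub>g'[OF s, of k] by (intro norm_triangle_mono)
      then show ?thesis
        using \<zeta> by (simp add: \<kappa>\<^sub>u mult.assoc)
    qed
    have solution: "\<exists>y\<in>borel_measurable (F k).
        \<forall>s\<in>space P. stationary (J c (x k s)) (H k s) (z s) (y s)"
      if z: "z \<in> borel_measurable (F k)" for z
      unfolding space_F[of k, symmetric]
    proof (rule measurable_stationary[OF JF HF z \<kappa>\<^sub>J(1) _ _ \<zeta>])
      show "mnorm (J c (x k s)) \<le> \<kappa>\<^sub>J" "mnorm (H k s) \<le> \<kappa>\<^sub>H" if "s \<in> space (F k)" for s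
        using \<kappa>\<^sub>J' H_bound that by (simp_all add: space_F)
      show "\<zeta> * (norm w)\<^sup>2 \<le> inner w (H k s *v w)"
        if "s \<in> space (F k)" "J c (x k s) *v w = 0" for s w
        using curv that by (simp add: space_F)
    qed
    obtain u' where u'F: "u' \<in> borel_measurable (F k)"
      and u': "\<And>s. s \<in> space P \<Longrightarrow> stationary (J c (x k s)) (H k s) (b s) (u' s)"
      using solution[OF bF] by blast
    have "(\<lambda>s. - u' s) \<in> borel_measurable (F k)"
      using u'F by simp
    then obtain w where wF: "w \<in> borel_measurable (F k)"
      and w: "\<And>s. s \<in> space P \<Longrightarrow> stationary (J c (x k s)) (H k s) (- u' s) (w s)"
      using solution by blast
    \<comment> \<open>Boundedness of \<open>w\<close> makes its product with the noise
      integrable.\<close>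
    have w_bound: "norm (w s) \<le> inverse \<zeta> * \<kappa>\<^sub>u" if s: "s \<in> space P" for s
    proof -
      have "norm (w s) \<le> inverse \<zeta> * norm (u' s)"
        using stationary_norm_le[OF w[OF s] \<zeta> curv[OF s]] by simp
      also have "\<dots> \<le> inverse \<zeta> * (inverse \<zeta> * norm (b s))"
        using \<zeta> by (intro mult_left_mono stationary_norm_le[OF u'[OF s] \<zeta> curv[OF s]]) auto
      also have "\<dots> \<le> inverse \<zeta> * \<kappa>\<^sub>u"
        using \<zeta> by (intro mult_left_mono b_bound[OF s]) auto
      finally show ?thesis .
    qed
    define D where "D s = inner (w s) (g k s - m s)" for s
    define V where "V s = (norm (g k s - m s))\<^sup>2" for s
    have int_V: "integrable P V" and V: "(\<integral>s. V s \<partial>P) \<le> M"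
      using Fk.square_integrable_cond_bound[OF gP mF _ var[of k, folded m_def]] M
      by (auto simp: V_def[abs_def] P.prob_space)
    have int_D: "integrable P D" and D: "(\<integral>s. D s \<partial>P) = 0"
      using Fk.inner_centered_integral_zero[OF gP mF wF _ w_bound int_V[unfolded V_def[abs_def]]
          mean[of k, folded m_def]] \<kappa>\<^sub>g'
      by (auto simp: D_def[abs_def] m_def)
    \<comment> \<open>\<open>q\<close> is the coefficient of the noise variance and \<open>r\<close>
      the deterministic rest, so that \<open>r + q * M\<close> is
      \<open>(\<beta> k)\<^sup>2 * \<kappa>\<^sub>3\<close>.\<close>
    define r where "r = \<Gamma> * (\<beta> k)\<^sup>2
      * (\<theta>\<^sup>2 * \<kappa>\<^sub>J\<^sup>2 * \<kappa>\<^sub>c\<^sup>2 * \<omega>\<^sup>2 + 1/2 * (inverse \<zeta> * \<kappa>\<^sub>H * \<kappa>\<^sub>u\<^sup>2))"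
    define q where "q = \<Gamma> * (\<beta> k)\<^sup>2 * (1/2 * (inverse \<zeta>)\<^sup>2)"
    \<comment> \<open>\<open>u\<close> is eliminated before integration in favour of
      \<open>D\<close> and \<open>V\<close>, whose integrability is known. As the bound holds at
      every sample point, the dependence of \<alpha> on \<open>g\<close> does no harm.\<close>
    have pointwise: "a * (h k s)\<^sup>2 \<le> norm (c (x k s)) - norm (c (x (Suc k) s))
        + (r - \<Gamma> * (\<beta> k)\<^sup>2 * D s + q * V s)" if s: "s \<in> space P" for s
    proof -
      have st: "stationary (J c (x k s)) (H k s) (b s + (g k s - m s)) (u k s)"
        using tangential_step_stationary[OF H_sym[OF s] u_step[OF s]]
        by (simp add: b_def algebra_simps)
      \<comment> \<open>The second upper bound on \<open>\<nu>\<close> enters here.\<close>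
      have "\<alpha> k s \<le> 1"
      proof -
        have "\<alpha> k s \<le> \<nu> + \<theta> * \<beta> k" using \<alpha>(2) s by simp
        also have "\<dots> \<le> \<nu> + \<theta> * \<kappa>\<^sub>\<beta>" using \<alpha>(1) \<beta>_bounds by simp
        also have "\<dots> \<le> 1" using \<nu> by simp
        finally show ?thesis .
      qed
      then have dec: "a * (h k s)\<^sup>2 \<le> norm (c (x k s)) - norm (c (x (Suc k) s))
          + \<Gamma> * (\<beta> k)\<^sup>2 * (\<theta>\<^sup>2 * \<kappa>\<^sub>J\<^sup>2 * \<kappa>\<^sub>c\<^sup>2 * \<omega>\<^sup>2 + 1/2 * (norm (u k s))\<^sup>2)"
        unfolding a_def h_def x_step[OF s]
        using xX[OF s, of "Suc k", unfolded x_step[OF s]] v_step[OF s, of k] st s \<nu> \<alpha>(2) \<kappa>\<^sub>v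
        by (intro constraint_decrease[where X=X] X xX c_diff \<Gamma> J_Lip \<kappa>\<^sub>c \<kappa>\<^sub>c' \<kappa>\<^sub>J' \<omega>)
          (auto simp: normal_step_def stationary_def)
      have "(norm (u k s))\<^sup>2 \<le> inverse \<zeta> * \<kappa>\<^sub>H * (inverse \<zeta> * norm (b s))\<^sup>2
          - 2 * D s + (inverse \<zeta>)\<^sup>2 * V s"
        unfolding D_def V_def
        by (rule stationary_perturbation[OF st u'[OF s] w[OF s] H_sym[OF s] H_bound[OF s] \<zeta> curv[OF s]])
      also have "inverse \<zeta> * \<kappa>\<^sub>H * (inverse \<zeta> * norm (b s))\<^sup>2 \<le> inverse \<zeta> * \<kappa>\<^sub>H * \<kappa>\<^sub>u\<^sup>2"
        using \<zeta> b_bound[OF s] order_trans[OF mnorm_nonneg H_bound[OF s]]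
        by (intro mult_left_mono power_mono) auto
      finally have "(norm (u k s))\<^sup>2 \<le> inverse \<zeta> * \<kappa>\<^sub>H * \<kappa>\<^sub>u\<^sup>2 - 2 * D s + (inverse \<zeta>)\<^sup>2 * V s"
        by simp
      then have "\<Gamma> * (\<beta> k)\<^sup>2 * (\<theta>\<^sup>2 * \<kappa>\<^sub>J\<^sup>2 * \<kappa>\<^sub>c\<^sup>2 * \<omega>\<^sup>2 + 1/2 * (norm (u k s))\<^sup>2)
          \<le> \<Gamma> * (\<beta> k)\<^sup>2 * (\<theta>\<^sup>2 * \<kappa>\<^sub>J\<^sup>2 * \<kappa>\<^sub>c\<^sup>2 * \<omega>\<^sup>2
            + 1/2 * (inverse \<zeta> * \<kappa>\<^sub>H * \<kappa>\<^sub>u\<^sup>2 - 2 * D s + (inverse \<zeta>)\<^sup>2 * V s))"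
        using \<Gamma> by (intro mult_left_mono add_left_mono) auto
      also have "\<dots> = r - \<Gamma> * (\<beta> k)\<^sup>2 * D s + q * V s"
        by (simp add: r_def q_def algebra_simps)
      finally show ?thesis
        using dec by linarith
    qed
    have "a * (\<integral>s. (h k s)\<^sup>2 \<partial>P) = (\<integral>s. a * (h k s)\<^sup>2 \<partial>P)"
      by simp
    also have "\<dots> \<le> (\<integral>s. norm (c (x k s)) - norm (c (x (Suc k) s))
        + (r - \<Gamma> * (\<beta> k)\<^sup>2 * D s + q * V s) \<partial>P)"
      by (intro integral_mono pointwise) (use int_c int_h int_D int_V in auto)
    also have "\<dots> = C k - C (Suc k) + (r + q * (\<integral>s. V s \<partial>P))"
      using int_c int_D int_V by (simp add: C_def D P.prob_space)
    also have "q * (\<integral>s. V s \<partial>P) \<le> q * M"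
      using V \<Gamma> by (intro mult_left_mono) (auto simp: q_def)
    also have "r + q * M = (\<beta> k)\<^sup>2 * \<kappa>\<^sub>3"
      by (simp add: r_def q_def \<kappa>\<^sub>3 algebra_simps)
    finally show ?thesis by simp
  qed
  have "a * (\<Sum>k<K. \<integral>s. (h k s)\<^sup>2 \<partial>P) \<le> (\<Sum>k<K. C k - C (Suc k) + (\<beta> k)\<^sup>2 * \<kappa>\<^sub>3)"
    unfolding sum_distrib_left by (intro sum_mono decrease)
  \<comment> \<open>The differences telescope, and the \<open>K\<close> terms
    \<open>\<eta>\<^sup>2 / K\<close> add up to \<open>\<eta>\<^sup>2\<close>, as \<open>K\<close>
    is not zero.\<close>
  also have "\<dots> = C 0 - C K + \<eta>\<^sup>2 * \<kappa>\<^sub>3"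
    using K \<beta>(2) by (simp add: sum.distrib sum_lessThan_telescope' power_divide)
  also have "C 0 = norm (c x\<^sub>0)"
  proof -
    have "C 0 = (\<integral>s. norm (c x\<^sub>0) \<partial>P)"
      unfolding C_def by (rule Bochner_Integration.integral_cong) (simp_all add: x0)
    then show ?thesis by (simp add: P.prob_space)
  qed
  finally have "a * (\<Sum>k<K. \<integral>s. (h k s)\<^sup>2 \<partial>P) \<le> norm (c x\<^sub>0) - C K + \<eta>\<^sup>2 * \<kappa>\<^sub>3" .
  moreover have "0 \<le> C K"
    by (simp add: C_def)
  ultimately have sum: "a * (\<Sum>k<K. \<integral>s. (h k s)\<^sup>2 \<partial>P) \<le> norm (c x\<^sub>0) + \<eta>\<^sup>2 * \<kappa>\<^sub>3"
    by linarith
  have a: "0 < a" "2 * \<kappa>\<^sub>c / (\<nu> * \<kappa>\<^sub>v) = 1 / a"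
    using \<nu> \<kappa>\<^sub>v(1) \<kappa>\<^sub>c(1) by (auto simp: a_def)
  then have "(\<Sum>k<K. \<integral>s. (h k s)\<^sup>2 \<partial>P) \<le> 1 / a * (norm (c x\<^sub>0) + \<eta>\<^sup>2 * \<kappa>\<^sub>3)"
    using sum by (simp add: field_simps)
  then have "1 / real K * (\<Sum>k<K. \<integral>s. (h k s)\<^sup>2 \<partial>P)
      \<le> 1 / real K * (2 * \<kappa>\<^sub>c / (\<nu> * \<kappa>\<^sub>v) * (norm (c x\<^sub>0) + \<eta>\<^sup>2 * \<kappa>\<^sub>3))"
    unfolding a(2) by (intro mult_left_mono) auto
  then show ?thesis
    by (simp add: h_def mult_ac)
qed

end
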